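(* Let $\alpha=\beta\in(0,1]$, let $\lambda,\mu>0$ be arbitrary, let $K\ge 1$ be an integer, and let $p_1,\dots,p_K>0$ be arbitrary with $p_1+\dots+p_K=1$. Consider the restless multiclass Mittag-Leffler queue with $K$ priority classes, arrival process ${\rm FPP}(\alpha,\lambda)$, class probabilities $p_1,\dots,p_K$, and departure process ${\rm FPP}(\beta,\mu)={\rm FPP}(\alpha,\mu)$. Let $Q_i(t)$ be the number of class $i$ customers present at time $t$, $Q_{\le i}(t)=\sum_{\ell=1}^iQ_\ell(t)$, and $Q(t)=Q_{\le K}(t)$. Then, irrespective of the values of $\lambda,\mu,p_1,\dots,p_K$: (1) The queue empties infinitely often with probability $1$, i.e. almost surely for every $T>0$ there is $t>T$ with $Q(t)=0$. (2) For every $1\le i\le K$, $\limsup_{t\to\infty}Q_{\le i}(t)=+\infty$ with probability $1$.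
   Context: Mittag-Leffler function: $E_\theta(z)=\sum_{\ell\ge 0} z^\ell/\Gamma(1+\theta\ell)$. Fractional Poisson process: for $\theta\in(0,1]$ and $\lambda>0$, ${\rm FPP}(\theta,\lambda)$ denotes the law of the counting process $N^{\theta,\lambda}(t)=\max\{n\ge 0: X_1+\dots+X_n\le t\}$, $t\ge 0$, where $X_1,X_2,\dots$ are i.i.d. nonnegative random variables with distribution function $F(x)=1-E_\theta(-\lambda^\theta x^\theta)$, $x\ge 0$. For $\theta=1$ this is a Poisson process of rate $\lambda$. Restless multiclass Mittag-Leffler queue: the arrival process $N^{\alpha,\lambda}\sim{\rm FPP}(\alpha,\lambda)$ and the departure process $D^{\beta,\mu}\sim{\rm FPP}(\beta,\mu)$ are independent, and the queue is empty at time $0$. At each jump of $N^{\alpha,\lambda}$ one customer arrives and is placed, independently of everything else, in class $i$ with probability $p_i$ ($1\le i\le K$), so $Q_i$ increases by $1$. At each jump of $D^{\beta,\mu}$, if the queue is nonempty, the earliest-arrived customer of the nonempty class with the smallest index leaves (that class's $Q_j$ decreases by $1$); if the queue is empty, nothing happens. The total queue length satisfies $$Q(t)=\sum_{i=1}^KQ_i(t)=N^{\alpha,\lambda}(t)-D^{\beta,\mu}(t)-\inf_{0\le s\le t}\{N^{\alpha,\lambda}(s)-D^{\beta,\mu}(s)\}.$$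
   Formalization: Part (1) is stated only for α<1 or λ≤μ; it is false for α=β=1 and λ>μ, where the queue is a transient M/M/1 queue with Q(t)→∞ almost surely. Part (2) is stated for all parameters. *)

theory Defs
  imports "HOL-Probability.Probability"
begin

definition mittag_leffler :: "real \<Rightarrow> real \<Rightarrow> real" where
  "mittag_leffler \<theta> z = (\<Sum>l. z ^ l / Gamma (1 + \<theta> * real l))"

text \<open>
  Sequences are indexed from 0: \<open>x n\<close> is the waiting time before the \<open>(n+1)\<close>-st jump.
\<close>

definition epoch :: "(nat \<Rightarrow> real) \<Rightarrow> nat \<Rightarrow> real" where
  "epoch x n = (\<Sum>k<n. x k)"

text \<open>
  If the epochs have a finite limit, the maximum below need not exist and \<open>Max\<close> is then
  unspecified; for i.i.d. waiting times that are not almost surely 0 this is a null event.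
\<close>

definition counting :: "(nat \<Rightarrow> real) \<Rightarrow> real \<Rightarrow> nat" where
  "counting x t = Max {n. epoch x n \<le> t}"

text \<open>
  The queue is built path by path from the interarrival times \<open>x\<close>, the waiting times \<open>y\<close>
  between the jumps of the departure process, and the class \<open>c n\<close> of customer \<open>n\<close>,
  customers being numbered by order of arrival from 0. Customers that have arrived by
  time \<open>t\<close> are thus \<open>{..<counting x t}\<close>. The set \<open>selected c W\<close> contains the customer who
  leaves when the set of waiting customers is \<open>W\<close>; it is empty when \<open>W\<close> is.
\<close>

definition selected :: "(nat \<Rightarrow> nat) \<Rightarrow> nat set \<Rightarrow> nat set" where
  "selected c W = (if W = {} then {} else {Min {n \<in> W. c n = Min (c ` W)}})"

text \<open>
  Customers who have left after the first \<open>k\<close> jumps of the departure process. An arrival at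
  the very instant of a departure jump (a null event in the model below) is counted first,
  in agreement with \<open>Q = N - D - inf (N - D)\<close>.
\<close>

primrec departed :: "(nat \<Rightarrow> real) \<Rightarrow> (nat \<Rightarrow> real) \<Rightarrow> (nat \<Rightarrow> nat) \<Rightarrow> nat \<Rightarrow> nat set" where
  "departed x y c 0 = {}"
| "departed x y c (Suc k) =
     departed x y c k \<union>
     selected c ({..<counting x (epoch y (Suc k))} - departed x y c k)"

definition present :: "(nat \<Rightarrow> real) \<Rightarrow> (nat \<Rightarrow> real) \<Rightarrow> (nat \<Rightarrow> nat) \<Rightarrow> real \<Rightarrow> nat set" where
  "present x y c t = {..<counting x t} - departed x y c (counting y t)"

definition queue :: "(nat \<Rightarrow> real) \<Rightarrow> (nat \<Rightarrow> real) \<Rightarrow> (nat \<Rightarrow> nat) \<Rightarrow> nat \<Rightarrow> real \<Rightarrow> nat" where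
  "queue x y c i t = card {n \<in> present x y c t. c n = i}"

definition queue_upto :: "(nat \<Rightarrow> real) \<Rightarrow> (nat \<Rightarrow> real) \<Rightarrow> (nat \<Rightarrow> nat) \<Rightarrow> nat \<Rightarrow> real \<Rightarrow> nat" where
  "queue_upto x y c i t = (\<Sum>l=1..i. queue x y c l t)"

text \<open>
  Interarrival times \<open>X\<close>, waiting times \<open>Y\<close> of the departure process and classes \<open>C\<close>.
  The assumption \<open>indep\<close> is joint independence of all these variables: it gives independence
  within each sequence, of the arrival and departure processes, and of the classes from
  everything else. The classes are embedded into the reals only because \<open>indep_vars\<close> needs a
  common value type.
\<close>

locale mittag_leffler_queue = prob_space M
  for M :: "'w measure" +
  fixes \<alpha> lam \<beta> \<mu> :: real
    and K :: nat and p :: "nat \<Rightarrow> real"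
    and X Y :: "nat \<Rightarrow> 'w \<Rightarrow> real" and C :: "nat \<Rightarrow> 'w \<Rightarrow> nat"
  assumes indep: "indep_vars (\<lambda>_ :: nat + nat + nat. borel)
      (case_sum X (case_sum Y (\<lambda>n \<omega>. real (C n \<omega>)))) UNIV"
    and X_nonneg: "\<And>n \<omega>. \<omega> \<in> space M \<Longrightarrow> 0 \<le> X n \<omega>"
    and Y_nonneg: "\<And>n \<omega>. \<omega> \<in> space M \<Longrightarrow> 0 \<le> Y n \<omega>"
    and X_cdf: "\<And>n x. 0 \<le> x \<Longrightarrow>
      cdf (distr M borel (X n)) x = 1 - mittag_leffler \<alpha> (- (lam powr \<alpha> * x powr \<alpha>))"
    and Y_cdf: "\<And>n x. 0 \<le> x \<Longrightarrow>
      cdf (distr M borel (Y n)) x = 1 - mittag_leffler \<beta> (- (\<mu> powr \<beta> * x powr \<beta>))"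
    and C_range: "\<And>n \<omega>. \<omega> \<in> space M \<Longrightarrow> C n \<omega> \<in> {1..K}"
    and C_prob: "\<And>n i. i \<in> {1..K} \<Longrightarrow> \<P>(\<omega> in M. C n \<omega> = i) = p i"

end

theory Submission
  imports Defs "HOL-Complex_Analysis.Conformal_Mappings"
begin

text \<open>
  The Laplace transform of a Mittag-Leffler waiting time is \<open>1 / (1 + (s / lam) powr \<alpha>)\<close>: integrate
  the series termwise for \<open>s > lam\<close> and continue analytically to all \<open>s > 0\<close>.

  Emptying: if every departure after some time were effective, the departure process could not
  overtake the arrival process by arbitrarily many jumps. It does so as soon as the partial sums of
  \<open>X k - Y (k + m)\<close> are unbounded above for every \<open>m\<close>. By Kolmogorov's 0-1 law it suffices that they
  exceed every level with probability bounded below. For \<open>\<alpha> < 1\<close> this follows from Chernoff type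
  bounds by the Laplace transform at the scale \<open>n powr (1 / \<alpha>)\<close>: small sums have probability at
  least \<open>exp (- (u / \<mu>) powr \<alpha>) - exp (- u * b)\<close>, which is positive for large \<open>u\<close> whatever the
  rates are.

  Growth: let \<open>r\<close> consecutive customers, all of class 1, arrive within time \<open>\<epsilon>\<close>, and let
  the waiting time following the first departure jump after the start of this block be longer
  than \<open>\<epsilon>\<close>. Then at most one of these customers leaves before the last one arrives. Given
  the past, this has probability bounded below, so it happens infinitely often.
\<close>

section \<open>The Laplace transform of the Mittag-Leffler distribution\<close>

text \<open>Euler's integral for the Gamma function under the substitution \<open>t = s * x\<close>.
  It evaluates one term of the Mittag-Leffler series against the density
  \<open>s * exp (- s * x)\<close>.\<close>

lemma has_bochner_integral_exp_powr:
  fixes a s :: real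
  assumes "0 \<le> a" "0 < s"
  shows "has_bochner_integral lborel (\<lambda>x. indicator {0<..} x * (s * exp (- s * x) * x powr a))
           (Gamma (1 + a) / s powr a)"
proof (rule has_bochner_integral_nn_integral)
  let ?g = "\<lambda>t::real. ennreal (indicator {0..} t * t powr (1 + a - 1) / exp t)"
  let ?f = "\<lambda>x. indicator {0<..} x * (s * exp (- s * x) * x powr a)"
  have "ennreal (Gamma (1 + a)) = (\<integral>\<^sup>+t. ?g t \<partial>lborel)"
    using assms by (intro Gamma_conv_nn_integral_real) simp
  also have "\<dots> = ennreal \<bar>s\<bar> * (\<integral>\<^sup>+x. ?g (0 + s * x) \<partial>lborel)"
    using assms by (intro nn_integral_real_affine) auto
  also have "\<dots> = (\<integral>\<^sup>+x. ennreal s * ?g (s * x) \<partial>lborel)"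
    using assms by (simp add: nn_integral_cmult)
  also have "\<dots> = (\<integral>\<^sup>+x. ennreal (s powr a) * ennreal (?f x) \<partial>lborel)"
    using assms by (intro nn_integral_cong_AE AE_I[where N = "{0}"])
      (auto simp: indicator_def powr_mult exp_minus divide_simps zero_le_mult_iff
            simp flip: ennreal_mult)
  also have "\<dots> = ennreal (s powr a) * (\<integral>\<^sup>+x. ennreal (?f x) \<partial>lborel)"
    by (intro nn_integral_cmult) auto
  finally have *: "ennreal (Gamma (1 + a)) = ennreal (s powr a) * (\<integral>\<^sup>+x. ennreal (?f x) \<partial>lborel)" .
  have "ennreal (inverse (s powr a)) * ennreal (Gamma (1 + a)) = (\<integral>\<^sup>+x. ennreal (?f x) \<partial>lborel)"
    unfolding * using assms by (simp flip: mult.assoc ennreal_mult)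
  then show "(\<integral>\<^sup>+x. ennreal (?f x) \<partial>lborel) = ennreal (Gamma (1 + a) / s powr a)"
    using assms Gamma_real_pos[of "1 + a"]
    by (metis add_pos_nonneg divide_inverse ennreal_mult inverse_nonnegative_iff_nonnegative
          less_imp_le mult.commute powr_ge_zero zero_less_one)
next
  show "0 \<le> Gamma (1 + a) / s powr a"
    using assms by (intro divide_nonneg_nonneg) auto
qed (use assms in \<open>auto\<close>)

text \<open>The Gamma factors cancel, so term \<open>l\<close> of the series integrates to
  \<open>(- q) ^ l\<close> with \<open>q = (lam / s) powr \<alpha>\<close>. For
  \<open>s > lam\<close> the integrals of the absolute values form a convergent geometric series,
  which permits exchanging sum and integral.\<close>

lemma has_bochner_integral_exp_mittag_leffler:
  fixes \<alpha> lam s :: real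
  assumes "0 < \<alpha>" "0 < lam" "lam < s"
  shows "has_bochner_integral lborel
           (\<lambda>x. indicator {0<..} x * (s * exp (- s * x)) * mittag_leffler \<alpha> (- (lam powr \<alpha> * x powr \<alpha>)))
           (1 / (1 + (lam / s) powr \<alpha>))"
proof -
  define q where "q = (lam / s) powr \<alpha>"
  have q: "0 < q" "q < 1"
    using assms powr_less_mono2[of \<alpha> "lam / s" 1] by (auto simp: q_def)
  define G where "G l = Gamma (1 + \<alpha> * real l)" for l
  have G: "0 < G l" for l
    using assms by (auto simp: G_def intro!: Gamma_real_pos add_pos_nonneg)
  define f where "f l x = indicator {0<..} x * (s * exp (- s * x)) *
      ((- (lam powr \<alpha> * x powr \<alpha>)) ^ l / G l)" for l x
  define b where "b l x = indicator {0<..} x * (s * exp (- s * x) * x powr (\<alpha> * real l))" for l x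
  \<comment> \<open>The indicator of the open half-line removes \<open>x = 0\<close>, where
    \<open>0 powr 0 = 0\<close> would disagree with the zeroth power, which is 1.\<close>
  have fb: "f l x = ((-1) ^ l * lam powr (\<alpha> * l) / G l) * b l x" for l x
  proof -
    have "(- (lam powr \<alpha> * x powr \<alpha>)) ^ l = (-1) ^ l * (lam powr (\<alpha> * l) * x powr (\<alpha> * l))" if "0 < x"
      using that assms by (subst power_minus) (simp add: power_mult_distrib powr_power mult.commute)
    then show ?thesis
      by (auto simp: f_def b_def indicator_def)
  qed
  have b: "has_bochner_integral lborel (b l) (G l / s powr (\<alpha> * l))" for l
    unfolding b_def G_def using assms by (intro has_bochner_integral_exp_powr) auto
  have ql: "lam powr (\<alpha> * l) / s powr (\<alpha> * l) = q ^ l" for l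
    unfolding q_def using assms by (simp add: powr_divide powr_powr[symmetric] powr_realpow power_divide)
  have f: "has_bochner_integral lborel (f l) ((- q) ^ l)" for l
  proof -
    have "((-1) ^ l * lam powr (\<alpha> * l) / G l) * (G l / s powr (\<alpha> * l)) = (-1) ^ l * q ^ l"
      using G[of l] unfolding ql[symmetric] by simp
    also have "\<dots> = (- q) ^ l" by (rule power_minus[symmetric])
    finally show ?thesis
      using has_bochner_integral_mult_right[OF b[of l], of "(-1) ^ l * lam powr (\<alpha> * l) / G l"]
      unfolding fb[abs_def] by simp
  qed
  have nf: "norm (f l x) = (lam powr (\<alpha> * l) / G l) * b l x" for l x
    using G[of l] assms by (auto simp: fb abs_mult b_def indicator_def power_abs)
  have fn: "has_bochner_integral lborel (\<lambda>x. norm (f l x)) (q ^ l)" for l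
  proof -
    have "(lam powr (\<alpha> * l) / G l) * (G l / s powr (\<alpha> * l)) = q ^ l"
      using G[of l] unfolding ql[symmetric] by simp
    then show ?thesis
      using has_bochner_integral_mult_right[OF b[of l], of "lam powr (\<alpha> * l) / G l"]
      unfolding nf by simp
  qed
  have int: "integrable lborel (f l)" for l
    using f by (auto simp: has_bochner_integral_iff)
  note [measurable] = borel_measurable_integrable[OF int]
  have summ: "summable (\<lambda>l. q ^ l)"
    using q by (intro summable_geometric) auto
  \<comment> \<open>Convergence of the series is obtained almost everywhere from the finite total
    integral, instead of from growth estimates for the Gamma function.\<close>
  have AEs: "AE x in lborel. summable (\<lambda>l. norm (f l x))"
  proof -
    have "(\<integral>\<^sup>+x. (\<Sum>l. ennreal (norm (f l x))) \<partial>lborel) = (\<Sum>l. \<integral>\<^sup>+x. ennreal (norm (f l x)) \<partial>lborel)"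
      by (intro nn_integral_suminf) auto
    also have "\<dots> = (\<Sum>l. ennreal (q ^ l))"
      by (intro arg_cong[where f = suminf] ext, subst nn_integral_eq_integral)
         (use fn in \<open>auto simp: has_bochner_integral_iff\<close>)
    also have "\<dots> < \<infinity>"
      using summ q by (simp add: suminf_ennreal2)
    finally have "AE x in lborel. (\<Sum>l. ennreal (norm (f l x))) \<noteq> \<infinity>"
      by (intro nn_integral_noteq_infinite) auto
    then show ?thesis
      by eventually_elim (auto intro: summable_suminf_not_top)
  qed
  have sums: "summable (\<lambda>l. \<integral>x. norm (f l x) \<partial>lborel)"
    using fn summ by (simp add: has_bochner_integral_iff)
  have "has_bochner_integral lborel (\<lambda>x. \<Sum>l. f l x) (1 / (1 + q))"
    unfolding has_bochner_integral_iff
  proof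
    show "integrable lborel (\<lambda>x. \<Sum>l. f l x)"
      by (intro integrable_suminf int AEs sums)
    have "(\<integral>x. (\<Sum>l. f l x) \<partial>lborel) = (\<Sum>l. integral\<^sup>L lborel (f l))"
      by (intro integral_suminf int AEs sums)
    also have "\<dots> = (\<Sum>l. (- q) ^ l)"
      using f by (simp add: has_bochner_integral_iff)
    also have "\<dots> = 1 / (1 + q)"
      using q by (subst suminf_geometric) auto
    finally show "(\<integral>x. (\<Sum>l. f l x) \<partial>lborel) = 1 / (1 + q)" .
  qed
  moreover have "AE x in lborel. (\<Sum>l. f l x) = indicator {0<..} x * (s * exp (- s * x)) *
     mittag_leffler \<alpha> (- (lam powr \<alpha> * x powr \<alpha>))"
    using AEs
  proof eventually_elim
    case (elim x)
    show ?case
    proof (cases "0 < x")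
      case True
      have "summable (\<lambda>l. (s * exp (- s * x)) * ((- (lam powr \<alpha> * x powr \<alpha>)) ^ l / G l))"
        using summable_norm_cancel[OF elim] True by (simp add: f_def)
      then have "summable (\<lambda>l. (- (lam powr \<alpha> * x powr \<alpha>)) ^ l / G l)"
        using assms by (subst (asm) summable_cmult_iff) auto
      then show ?thesis
        unfolding f_def mittag_leffler_def G_def[symmetric] by (rule suminf_mult)
    qed (auto simp: f_def)
  qed
  moreover have "(\<lambda>x. indicator {0<..} x * (s * exp (- s * x)) *
     mittag_leffler \<alpha> (- (lam powr \<alpha> * x powr \<alpha>))) \<in> borel_measurable lborel"
    unfolding mittag_leffler_def by measurable
  ultimately show ?thesis
    unfolding q_def by (subst (asm) has_bochner_integral_cong_AE) (auto simp: has_bochner_integral_iff)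
qed

text \<open>Writing \<open>exp (- s * a)\<close> as the integral of \<open>s * exp (- s * x)\<close>
  over \<open>x \<ge> a\<close> and exchanging the integrals produces the probability of
  \<open>X \<le> x\<close>. The exchange is made for nonnegative integrals, where it holds without
  integrability.\<close>

lemma (in prob_space) expectation_exp_eq_integral_cdf:
  fixes X :: "'a \<Rightarrow> real"
  assumes [measurable]: "random_variable borel X" and nonneg: "\<And>\<omega>. \<omega> \<in> space M \<Longrightarrow> 0 \<le> X \<omega>"
    and s: "0 < s"
  shows "expectation (\<lambda>\<omega>. exp (- s * X \<omega>)) =
           (\<integral>x. indicator {0<..} x * (s * exp (- s * x)) * cdf (distr M borel X) x \<partial>lborel)"
proof -
  interpret D: real_distribution "distr M borel X"
    by (rule real_distribution_distr) simp
  interpret P: pair_sigma_finite M lborel ..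
  have exp_eq: "ennreal (exp (- s * a)) =
      (\<integral>\<^sup>+x. ennreal (s * exp (- s * x)) * indicator {a..} x \<partial>lborel)" for a
  proof -
    have "(\<integral>\<^sup>+x. ennreal (s * exp (- s * x)) * indicator {a..} x \<partial>lborel) = ennreal (0 - (- exp (- s * a)))"
    proof (rule nn_integral_FTC_atLeast)
      have "((\<lambda>x. - exp (- s * x)) \<longlongrightarrow> - 0) at_top"
        by (intro tendsto_minus filterlim_compose[OF exp_at_bot]
              filterlim_tendsto_neg_mult_at_bot[OF tendsto_const] filterlim_ident) (use s in auto)
      then show "((\<lambda>x. - exp (- s * x)) \<longlongrightarrow> 0) at_top" by simp
    qed (use s in \<open>auto intro!: derivative_eq_intros\<close>)
    then show ?thesis by simp
  qed
  have "(\<integral>\<^sup>+\<omega>. ennreal (exp (- s * X \<omega>)) \<partial>M) =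
      (\<integral>\<^sup>+\<omega>. (\<integral>\<^sup>+x. ennreal (s * exp (- s * x)) * indicator {X \<omega>..} x \<partial>lborel) \<partial>M)"
    by (simp only: exp_eq)
  also have "\<dots> = (\<integral>\<^sup>+\<omega>. (\<integral>\<^sup>+x. ennreal (indicator {0<..} x * (s * exp (- s * x))) *
      indicator {\<omega>\<in>space M. X \<omega> \<le> x} \<omega> \<partial>lborel) \<partial>M)"
  \<comment> \<open>Since \<open>X\<close> is nonnegative, restricting to \<open>x > 0\<close>
    changes the inner integrand at most at \<open>x = 0\<close>.\<close>
  proof (rule nn_integral_cong, rule nn_integral_cong_AE, rule AE_I[where N = "{0}"])
    fix \<omega> assume "\<omega> \<in> space M"
    then show "{x \<in> space lborel. ennreal (s * exp (- s * x)) * indicator {X \<omega>..} x \<noteq>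
        ennreal (indicator {0<..} x * (s * exp (- s * x))) *
        indicator {\<omega>\<in>space M. X \<omega> \<le> x} \<omega>} \<subseteq> {0}"
      using nonneg[of \<omega>] by (auto simp: indicator_def)
  qed auto
  also have "\<dots> = (\<integral>\<^sup>+x. (\<integral>\<^sup>+\<omega>. ennreal (indicator {0<..} x * (s * exp (- s * x))) *
      indicator {\<omega>\<in>space M. X \<omega> \<le> x} \<omega> \<partial>M) \<partial>lborel)"
    by (intro P.Fubini'[symmetric]) measurable
  also have "\<dots> = (\<integral>\<^sup>+x. ennreal (indicator {0<..} x * (s * exp (- s * x)) * cdf (distr M borel X) x) \<partial>lborel)"
  proof (intro nn_integral_cong)
    fix x :: real
    have "X -` {..x} \<inter> space M = {\<omega>\<in>space M. X \<omega> \<le> x}" by auto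
    then have "cdf (distr M borel X) x = prob {\<omega>\<in>space M. X \<omega> \<le> x}"
      by (simp add: cdf_def measure_distr)
    then show "(\<integral>\<^sup>+\<omega>. ennreal (indicator {0<..} x * (s * exp (- s * x))) *
          indicator {\<omega>\<in>space M. X \<omega> \<le> x} \<omega> \<partial>M) =
        ennreal (indicator {0<..} x * (s * exp (- s * x)) * cdf (distr M borel X) x)"
      using s by (simp add: nn_integral_cmult_indicator emeasure_eq_measure ennreal_mult')
  qed
  finally have *: "(\<integral>\<^sup>+\<omega>. ennreal (exp (- s * X \<omega>)) \<partial>M) =
    (\<integral>\<^sup>+x. ennreal (indicator {0<..} x * (s * exp (- s * x)) * cdf (distr M borel X) x) \<partial>lborel)" .
  have [measurable]: "cdf (distr M borel X) \<in> borel_measurable borel"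
    by (intro borel_measurable_mono monoI D.cdf_nondecreasing)
  have "expectation (\<lambda>\<omega>. exp (- s * X \<omega>)) = enn2real (\<integral>\<^sup>+\<omega>. ennreal (exp (- s * X \<omega>)) \<partial>M)"
    by (intro integral_eq_nn_integral) auto
  also have "\<dots> = (\<integral>x. indicator {0<..} x * (s * exp (- s * x)) * cdf (distr M borel X) x \<partial>lborel)"
    unfolding * using s
    by (intro integral_eq_nn_integral[symmetric] AE_I2 mult_nonneg_nonneg D.cdf_nonneg) auto
  finally show ?thesis .
qed

lemma (in prob_space) laplace_mittag_leffler_large:
  fixes X :: "'a \<Rightarrow> real" and \<alpha> lam s :: real
  assumes X: "random_variable borel X" and nonneg: "\<And>\<omega>. \<omega> \<in> space M \<Longrightarrow> 0 \<le> X \<omega>"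
    and cdf: "\<And>x. 0 \<le> x \<Longrightarrow>
      cdf (distr M borel X) x = 1 - mittag_leffler \<alpha> (- (lam powr \<alpha> * x powr \<alpha>))"
    and "0 < \<alpha>" "0 < lam" "lam < s"
  shows "expectation (\<lambda>\<omega>. exp (- s * X \<omega>)) = 1 / (1 + (s / lam) powr \<alpha>)"
proof -
  let ?e = "\<lambda>x. indicator {0<..} x * (s * exp (- s * x))"
  let ?E = "\<lambda>x. mittag_leffler \<alpha> (- (lam powr \<alpha> * x powr \<alpha>))"
  have s: "0 < s" using assms by simp
  have e: "has_bochner_integral lborel ?e 1"
  proof -
    have "(\<lambda>x. indicator {0<..} x * (s * exp (- s * x) * x powr 0)) = ?e"
      by (auto simp: indicator_def)
    then show ?thesis
      using has_bochner_integral_exp_powr[of 0 s] s by simp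
  qed
  have m: "has_bochner_integral lborel (\<lambda>x. ?e x - ?e x * ?E x) (1 - 1 / (1 + (lam / s) powr \<alpha>))"
    by (intro has_bochner_integral_diff e has_bochner_integral_exp_mittag_leffler assms)
  have "expectation (\<lambda>\<omega>. exp (- s * X \<omega>)) = (\<integral>x. ?e x * cdf (distr M borel X) x \<partial>lborel)"
    by (rule expectation_exp_eq_integral_cdf[OF X nonneg s])
  also have "\<dots> = (\<integral>x. ?e x - ?e x * ?E x \<partial>lborel)"
    by (intro Bochner_Integration.integral_cong)
       (auto simp: cdf algebra_simps indicator_def)
  also have "\<dots> = 1 - 1 / (1 + (lam / s) powr \<alpha>)"
    using m by (simp add: has_bochner_integral_iff)
  also have "\<dots> = 1 / (1 + (s / lam) powr \<alpha>)"
  proof -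
    have v: "(s / lam) powr \<alpha> = 1 / (lam / s) powr \<alpha>"
      using assms s by (simp add: powr_divide)
    have "1 - 1 / (1 + u) = 1 / (1 + 1 / u)" if "0 < u" for u :: real
      using that by (simp add: field_simps)
    then show ?thesis
      unfolding v using assms s by simp
  qed
  finally show ?thesis .
qed

text \<open>Expansion of \<open>exp (- w * X)\<close> under the expectation. The absolute values of
  the terms sum to \<open>exp (- (s - \<bar>w\<bar>) * X)\<close>, which is at most 1, so dominated
  convergence applies. The transform is thus a power series about \<open>s\<close> with radius of
  convergence at least \<open>s\<close>.\<close>

lemma (in prob_space) laplace_power_series:
  fixes X :: "'a \<Rightarrow> real" and s w :: real
  assumes [measurable]: "random_variable borel X" and nonneg: "\<And>\<omega>. \<omega> \<in> space M \<Longrightarrow> 0 \<le> X \<omega>"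
    and w: "\<bar>w\<bar> < s"
  shows "(\<lambda>k. expectation (\<lambda>\<omega>. exp (- s * X \<omega>) * ((- X \<omega>) ^ k / fact k)) * w ^ k) sums
           expectation (\<lambda>\<omega>. exp (- (s + w) * X \<omega>))"
proof -
  define f where "f k \<omega> = exp (- s * X \<omega>) * ((- (w * X \<omega>)) ^ k / fact k)" for k \<omega>
  have nf: "norm (f k \<omega>) = exp (- s * X \<omega>) * ((\<bar>w\<bar> * X \<omega>) ^ k / fact k)"
    if "\<omega> \<in> space M" for k \<omega>
    using nonneg[OF that] by (simp add: f_def abs_mult power_abs)
  have exps: "(\<lambda>k. exp (- s * X \<omega>) * (y ^ k / fact k)) sums (exp (- s * X \<omega>) * exp y)" for y :: real and \<omega>
    using exp_converges[of y] by (intro sums_mult) (simp add: divide_inverse mult.commute)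
  have nsums: "(\<lambda>k. norm (f k \<omega>)) sums exp (- s * X \<omega> + \<bar>w\<bar> * X \<omega>)" if "\<omega> \<in> space M" for \<omega>
    by (simp only: nf[OF that] exp_add exps)
  have nsum_le: "(\<Sum>k<n. norm (f k \<omega>)) \<le> 1" if "\<omega> \<in> space M" for n \<omega>
  proof -
    have "(\<Sum>k<n. norm (f k \<omega>)) \<le> exp (- s * X \<omega> + \<bar>w\<bar> * X \<omega>)"
      using nsums[OF that] by (metis sum_le_suminf finite_lessThan norm_ge_zero sums_iff)
    also have "\<dots> \<le> 1"
      using w nonneg[OF that] by (simp add: mult_right_mono)
    finally show ?thesis .
  qed
  have [measurable]: "f k \<in> borel_measurable M" for k
    unfolding f_def by measurable
  have int: "integrable M (f k)" for k
  proof (rule integrable_const_bound[where B = 1])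
    show "AE \<omega> in M. norm (f k \<omega>) \<le> 1"
    proof (rule AE_I2)
      fix \<omega> assume "\<omega> \<in> space M"
      have "norm (f k \<omega>) \<le> (\<Sum>k<Suc k. norm (f k \<omega>))"
        by (intro member_le_sum) auto
      also have "\<dots> \<le> 1" by (rule nsum_le) fact
      finally show "norm (f k \<omega>) \<le> 1" .
    qed
  qed simp
  have "(\<lambda>k. expectation (f k)) sums expectation (\<lambda>\<omega>. \<Sum>k. f k \<omega>)"
  proof (rule sums_integral)
    show "AE \<omega> in M. summable (\<lambda>k. norm (f k \<omega>))"
      using nsums by (auto simp: sums_iff)
    show "summable (\<lambda>k. expectation (\<lambda>\<omega>. norm (f k \<omega>)))"
    proof (rule summableI_nonneg_bounded[where x = 1])
      fix n
      have "(\<Sum>k<n. expectation (\<lambda>\<omega>. norm (f k \<omega>))) = expectation (\<lambda>\<omega>. \<Sum>k<n. norm (f k \<omega>))"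
        using int by (intro Bochner_Integration.integral_sum[symmetric]) auto
      also have "\<dots> \<le> expectation (\<lambda>\<omega>. 1)"
        using nsum_le int by (intro integral_mono) auto
      finally show "(\<Sum>k<n. expectation (\<lambda>\<omega>. norm (f k \<omega>))) \<le> 1"
        by (simp add: prob_space)
    qed auto
  qed (rule int)
  moreover have "(\<Sum>k. f k \<omega>) = exp (- (s + w) * X \<omega>)" for \<omega>
  proof -
    have "(\<lambda>k. f k \<omega>) sums exp (- s * X \<omega> + - (w * X \<omega>))"
      unfolding f_def exp_add by (rule exps)
    then show ?thesis
      by (simp add: sums_iff algebra_simps)
  qed
  moreover have "expectation (f k) = expectation (\<lambda>\<omega>. exp (- s * X \<omega>) * ((- X \<omega>) ^ k / fact k)) * w ^ k" for k
  proof -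
    have "f k = (\<lambda>\<omega>. exp (- s * X \<omega>) * ((- X \<omega>) ^ k / fact k) * w ^ k)"
      unfolding f_def minus_mult_right power_mult_distrib by (simp add: fun_eq_iff)
    then show ?thesis by (simp only: integral_mult_left_zero)
  qed
  ultimately show ?thesis by simp
qed

text \<open>Both sides extend analytically to the disc of radius \<open>s0\<close> about
  \<open>s0\<close>. They agree at the real points of the disc to the right of \<open>s0\<close>,
  hence throughout the disc, which contains \<open>s\<close>.\<close>

lemma (in prob_space) laplace_mittag_leffler:
  fixes X :: "'a \<Rightarrow> real" and \<alpha> lam s :: real
  assumes X: "random_variable borel X" and nonneg: "\<And>\<omega>. \<omega> \<in> space M \<Longrightarrow> 0 \<le> X \<omega>"
    and cdf: "\<And>x. 0 \<le> x \<Longrightarrow>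
      cdf (distr M borel X) x = 1 - mittag_leffler \<alpha> (- (lam powr \<alpha> * x powr \<alpha>))"
    and "0 < \<alpha>" "0 < lam" "0 < s"
  shows "expectation (\<lambda>\<omega>. exp (- s * X \<omega>)) = 1 / (1 + (s / lam) powr \<alpha>)"
proof -
  \<comment> \<open>With this centre the point \<open>s\<close> corresponds to
    \<open>w = - lam\<close>, inside the disc because \<open>lam < s0\<close>, and every real
    \<open>w > 0\<close> falls under the case already known.\<close>
  define s0 where "s0 = lam + s"
  have s0: "0 < s0" "lam < s0" using assms by (auto simp: s0_def)
  define a where "a k = expectation (\<lambda>\<omega>. exp (- s0 * X \<omega>) * ((- X \<omega>) ^ k / fact k))" for k
  have a: "(\<lambda>k. a k * w ^ k) sums expectation (\<lambda>\<omega>. exp (- (s0 + w) * X \<omega>))" if "\<bar>w\<bar> < s0" for w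
    unfolding a_def using X nonneg that by (rule laplace_power_series)
  define h :: "complex \<Rightarrow> complex" where "h w = (\<Sum>k. of_real (a k) * w ^ k)" for w
  have h_real: "h (of_real w) = of_real (expectation (\<lambda>\<omega>. exp (- (s0 + w) * X \<omega>)))" if "\<bar>w\<bar> < s0" for w
    using sums_of_real[OF a[OF that], where 'a = complex] by (simp add: h_def sums_iff)
  have "h holomorphic_on ball 0 s0"
  proof (rule power_series_holomorphic)
    fix w :: complex assume w: "w \<in> ball 0 s0"
    \<comment> \<open>A radius strictly between \<open>norm w\<close> and \<open>s0\<close>:
      convergence at the real point \<open>r\<close> gives convergence at \<open>w\<close>.\<close>
    define r where "r = (norm w + s0) / 2"
    have r: "norm w < r" "r < s0" "0 \<le> r" using w s0 norm_ge_zero[of w] by (auto simp: r_def simp del: norm_ge_zero)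
    have "summable (\<lambda>k. of_real (a k * r ^ k) :: complex)"
      using a[of r] r by (intro summable_of_real) (auto simp: sums_iff)
    then have "summable (\<lambda>k. of_real (a k) * (of_real r :: complex) ^ k)"
      by simp
    then have "summable (\<lambda>k. of_real (a k) * w ^ k)"
      by (rule powser_inside) (use r in simp)
    then show "(\<lambda>k. of_real (a k) * (w - 0) ^ k) sums h w"
      by (simp add: h_def summable_sums)
  qed
  \<comment> \<open>On the disc \<open>s0 + w\<close> stays in the open right half-plane, away from
    the branch cut of the complex power.\<close>
  moreover have pos: "s0 + Re w > 0" if "w \<in> ball 0 s0" for w
    using that abs_Re_le_cmod[of w] by auto
  then have "(\<lambda>w. ((of_real s0 + w) / of_real lam) powr of_real \<alpha>) holomorphic_on ball 0 s0"
    using assms pos by (intro holomorphic_intros)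
      (fastforce simp: complex_nonpos_Reals_iff Re_divide_of_real divide_le_0_iff not_le)+
  \<comment> \<open>The denominator is cleared, so holomorphy does not depend on its being nonzero
    on the disc.\<close>
  ultimately have hol: "(\<lambda>w. h w * (1 + ((of_real s0 + w) / of_real lam) powr of_real \<alpha>) - 1) holomorphic_on ball 0 s0"
    (is "?g holomorphic_on _")
    by (intro holomorphic_on_diff holomorphic_on_mult holomorphic_on_add holomorphic_on_const)
  have g_real: "?g (of_real w) = of_real
      (expectation (\<lambda>\<omega>. exp (- (s0 + w) * X \<omega>)) * (1 + ((s0 + w) / lam) powr \<alpha>) - 1)" if "\<bar>w\<bar> < s0" for w
  proof -
    have "((of_real s0 + of_real w) / of_real lam :: complex) powr of_real \<alpha> = of_real (((s0 + w) / lam) powr \<alpha>)"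
      using that assms by (subst powr_of_real[symmetric]) auto
    then show ?thesis
      by (simp add: h_real[OF that])
  qed
  have "?g (of_real (- lam)) = 0"
  proof (rule analytic_continuation[OF hol])
    show "of_real ` {0<..<s0} \<subseteq> ball (0::complex) s0" by auto
    show "(0::complex) islimpt of_real ` {0<..<s0}"
    proof (rule islimptI)
      fix T :: "complex set" assume "0 \<in> T" "open T"
      then obtain e where e: "0 < e" "ball 0 e \<subseteq> T" by (auto simp: open_contains_ball)
      then show "\<exists>y\<in>of_real ` {0<..<s0}. y \<in> T \<and> y \<noteq> 0"
        using s0 by (intro bexI[where x = "of_real (min (e/2) (s0/2))"]) auto
    qed
    fix z assume "z \<in> complex_of_real ` {0<..<s0}"
    then obtain w where w: "z = of_real w" "0 < w" "w < s0" by auto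
    have "expectation (\<lambda>\<omega>. exp (- (s0 + w) * X \<omega>)) = 1 / (1 + ((s0 + w) / lam) powr \<alpha>)"
      using w s0 assms by (intro laplace_mittag_leffler_large X nonneg cdf) auto
    moreover have "1 + ((s0 + w) / lam) powr \<alpha> > 0"
      by (intro add_pos_nonneg) auto
    ultimately have "expectation (\<lambda>\<omega>. exp (- (s0 + w) * X \<omega>)) * (1 + ((s0 + w) / lam) powr \<alpha>) - 1 = 0"
      by simp
    then show "?g z = 0"
      using g_real[of w] w by simp
  qed (use s0 assms in auto)
  moreover have "\<bar>- lam\<bar> < s0"
    using s0 assms by simp
  ultimately have "complex_of_real (expectation (\<lambda>\<omega>. exp (- (s0 + - lam) * X \<omega>)) *
      (1 + ((s0 + - lam) / lam) powr \<alpha>) - 1) = 0"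
    using g_real[of "- lam"] by (simp only:)
  then have "expectation (\<lambda>\<omega>. exp (- s * X \<omega>)) * (1 + (s / lam) powr \<alpha>) - 1 = 0"
    by (simp only: of_real_eq_0_iff) (simp add: s0_def)
  moreover have "1 + (s / lam) powr \<alpha> > 0"
    by (intro add_pos_nonneg) auto
  ultimately show ?thesis by (simp add: field_simps)
qed

section \<open>Unbounded partial sums\<close>

text \<open>Dropping the first \<open>N\<close> terms shifts all later partial sums by one constant.
  This makes unboundedness a tail event.\<close>

lemma unbounded_partial_sums_iff_tail:
  fixes z :: "nat \<Rightarrow> real"
  shows "(\<forall>L::nat. \<exists>n. real L < (\<Sum>k<n. z k)) \<longleftrightarrow> (\<forall>L::nat. \<exists>n. real L < (\<Sum>k=N..<n. z k))"
proof -
  have split: "(\<Sum>k<n. z k) = (\<Sum>k<N. z k) + (\<Sum>k=N..<n. z k)" if "N \<le> n" for n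
    using sum.atLeastLessThan_concat[of 0 N n z] that by (simp add: lessThan_atLeast0)
  show ?thesis
  proof (intro iffI allI)
    fix L :: nat
    assume *: "\<forall>L::nat. \<exists>n. real L < (\<Sum>k<n. z k)"
    \<comment> \<open>\<open>B\<close> dominates all partial sums up to \<open>N\<close>, so an
      index whose sum exceeds \<open>L + B\<close> lies beyond \<open>N\<close>, where the sums
      split.\<close>
    define B where "B = (\<Sum>n\<le>N. \<bar>\<Sum>k<n. z k\<bar>)"
    have B: "\<bar>\<Sum>k<n. z k\<bar> \<le> B" if "n \<le> N" for n
      unfolding B_def using that by (intro member_le_sum) auto
    obtain n where n: "real (L + nat \<lceil>B\<rceil>) < (\<Sum>k<n. z k)"
      using * by blast
    have "real L + B < (\<Sum>k<n. z k)"
      using n real_nat_ceiling_ge[of B] by linarith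
    moreover have "N < n"
    proof (rule ccontr)
      assume "\<not> N < n"
      with B[of n] \<open>real L + B < (\<Sum>k<n. z k)\<close> show False by force
    qed
    ultimately show "\<exists>n. real L < (\<Sum>k=N..<n. z k)"
      using split[of n] B[of N] by (intro exI[of _ n]) auto
  next
    fix L :: nat
    assume *: "\<forall>L::nat. \<exists>n. real L < (\<Sum>k=N..<n. z k)"
    define B where "B = \<bar>\<Sum>k<N. z k\<bar>"
    obtain n where n: "real (L + nat \<lceil>B\<rceil>) < (\<Sum>k=N..<n. z k)"
      using * by blast
    then have "N \<le> n"
      by (cases "N \<le> n") auto
    have "real L + B < (\<Sum>k=N..<n. z k)"
      using n real_nat_ceiling_ge[of B] unfolding of_nat_add by linarith
    then have "real L < (\<Sum>k<n. z k)"
      using split[OF \<open>N \<le> n\<close>] unfolding B_def by linarith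
    then show "\<exists>n. real L < (\<Sum>k<n. z k)" ..
  qed
qed

text \<open>By Kolmogorov's law the event has probability 0 or 1. It is the decreasing intersection
  over \<open>L\<close> of the events that some partial sum exceeds \<open>L\<close>, each of
  probability at least \<open>c\<close>.\<close>

lemma (in prob_space) AE_unbounded_partial_sums:
  fixes Z :: "nat \<Rightarrow> 'a \<Rightarrow> real"
  assumes indep: "indep_vars (\<lambda>_. borel) Z UNIV" and c: "0 < c"
    and freq: "\<And>L. \<exists>n. c \<le> prob {\<omega>\<in>space M. L < (\<Sum>k<n. Z k \<omega>)}"
  shows "AE \<omega> in M. \<forall>L::nat. \<exists>n. real L < (\<Sum>k<n. Z k \<omega>)"
proof -
  define A where "A i = {Z i -` B \<inter> space M | B. B \<in> sets borel}" for i
  define E where "E = {\<omega>\<in>space M. \<forall>L::nat. \<exists>n. real L < (\<Sum>k<n. Z k \<omega>)}"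
  have [measurable]: "random_variable borel (Z i)" for i
    using indep by (auto simp: indep_vars_def)
  have E_sets[measurable]: "E \<in> events"
    unfolding E_def by measurable
  have "E \<in> tail_events A"
    unfolding tail_events_def
  proof
    fix N
    \<comment> \<open>\<open>S\<close> packages the sigma-algebra of the variables from
      \<open>N\<close> on as a measure space, which turns membership of \<open>E\<close> into a
      measurability claim.\<close>
    define S where "S = sigma (space M) (\<Union>(A ` {N..}))"
    have sub: "\<Union>(A ` {N..}) \<subseteq> Pow (space M)"
      by (auto simp: A_def)
    have space_S: "space S = space M" and sets_S: "sets S = sigma_sets (space M) (\<Union>(A ` {N..}))"
      using sub by (auto simp: S_def)
    have Z_S: "Z k \<in> borel_measurable S" if "N \<le> k" for k
    proof (rule measurableI)
      fix B :: "real set" assume "B \<in> sets borel"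
      then have "Z k -` B \<inter> space M \<in> A k" by (auto simp: A_def)
      then show "Z k -` B \<inter> space S \<in> sets S"
        using that unfolding sets_S space_S by (auto intro!: sigma_sets.Basic)
    qed auto
    have [measurable]: "(\<lambda>\<omega>. \<Sum>k=N..<n. Z k \<omega>) \<in> borel_measurable S" for n
      by (intro borel_measurable_sum Z_S) auto
    have "E = {\<omega>\<in>space S. \<forall>L::nat. \<exists>n. real L < (\<Sum>k=N..<n. Z k \<omega>)}"
      unfolding E_def space_S unbounded_partial_sums_iff_tail[where N = N] ..
    also have "\<dots> \<in> sets S"
      by measurable
    finally show "E \<in> sigma_sets (space M) (\<Union>(A ` {N..}))"
      unfolding sets_S .
  qed
  then have "prob E = 0 \<or> prob E = 1"
  proof (rule kolmogorov_0_1_law[rotated 2])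
    show "sigma_algebra (space M) (A i)" for i
      using sets.sigma_algebra_axioms[of "vimage_algebra (space M) (Z i) borel"]
      by (simp add: A_def sets_vimage_algebra2)
    show "indep_sets A UNIV"
      using indep by (simp add: indep_vars_def2 A_def[abs_def])
  qed
  moreover have "c \<le> prob E"
  proof -
    define F where "F L = {\<omega>\<in>space M. \<exists>n. real L < (\<Sum>k<n. Z k \<omega>)}" for L :: nat
    have [measurable]: "F L \<in> events" for L
      unfolding F_def by measurable
    have "decseq F"
    proof (rule decseq_SucI)
      fix L
      have "real L < x" if "real (Suc L) < x" for x using that by simp
      then show "F (Suc L) \<subseteq> F L" unfolding F_def by blast
    qed
    then have "(\<lambda>L. prob (F L)) \<longlonglongrightarrow> prob (\<Inter>L. F L)"
      by (intro finite_Lim_measure_decseq) auto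
    moreover have "(\<Inter>L. F L) = E"
      by (auto simp: F_def E_def)
    moreover have "c \<le> prob (F L)" for L
    proof -
      obtain n where "c \<le> prob {\<omega>\<in>space M. real L < (\<Sum>k<n. Z k \<omega>)}"
        using freq by blast
      also have "\<dots> \<le> prob (F L)"
        by (intro finite_measure_mono) (auto simp: F_def)
      finally show ?thesis .
    qed
    ultimately show ?thesis
      by (intro LIMSEQ_le_const[where X = "\<lambda>L. prob (F L)"]) auto
  qed
  ultimately have "prob E = 1"
    using c by linarith
  then have "AE \<omega> in M. \<omega> \<in> E"
    by (simp add: prob_eq_1)
  then show ?thesis
    by eventually_elim (simp add: E_def)
qed

section \<open>Exponential bounds and sums that exceed every level\<close>

lemma (in prob_space) expectation_exp_sum:
  fixes X :: "nat \<Rightarrow> 'a \<Rightarrow> real"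
  assumes indep: "indep_vars (\<lambda>_. borel) X UNIV"
    and nonneg: "\<And>k \<omega>. \<omega> \<in> space M \<Longrightarrow> 0 \<le> X k \<omega>" and s: "0 \<le> s"
    and laplace: "\<And>k. expectation (\<lambda>\<omega>. exp (- s * X k \<omega>)) = l"
  shows "expectation (\<lambda>\<omega>. exp (- s * (\<Sum>k<n. X k \<omega>))) = l ^ n"
proof -
  have [measurable]: "random_variable borel (X i)" for i
    using indep by (auto simp: indep_vars_def)
  have "expectation (\<lambda>\<omega>. exp (- s * (\<Sum>k<n. X k \<omega>))) = expectation (\<lambda>\<omega>. \<Prod>k<n. exp (- s * X k \<omega>))"
    by (simp add: sum_distrib_left exp_sum sum_negf flip: sum_negf)
  also have "\<dots> = (\<Prod>k<n. expectation (\<lambda>\<omega>. exp (- s * X k \<omega>)))"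
  proof (rule indep_vars_lebesgue_integral)
    show "indep_vars (\<lambda>_. borel) (\<lambda>k \<omega>. exp (- s * X k \<omega>)) {..<n}"
      by (rule indep_vars_compose2[OF indep_vars_subset[OF indep]]) auto
    show "integrable M (\<lambda>\<omega>. exp (- s * X k \<omega>))" for k
      using nonneg s by (intro integrable_const_bound[where B = 1] AE_I2) auto
  qed auto
  also have "\<dots> = l ^ n"
    unfolding laplace by simp
  finally show ?thesis .
qed

text \<open>Pointwise, \<open>exp (- s * S)\<close> is at most 1 where \<open>S < x\<close> and at
  most \<open>exp (- s * x)\<close> elsewhere.\<close>

lemma (in prob_space) prob_less_ge_laplace:
  fixes S :: "'a \<Rightarrow> real"
  assumes [measurable]: "random_variable borel S" and nonneg: "\<And>\<omega>. \<omega> \<in> space M \<Longrightarrow> 0 \<le> S \<omega>"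
    and s: "0 \<le> s"
  shows "expectation (\<lambda>\<omega>. exp (- s * S \<omega>)) - exp (- s * x) \<le> prob {\<omega>\<in>space M. S \<omega> < x}"
proof -
  have "expectation (\<lambda>\<omega>. exp (- s * S \<omega>)) \<le>
      expectation (\<lambda>\<omega>. exp (- s * x) + indicator {\<omega>\<in>space M. S \<omega> < x} \<omega>)"
  proof (rule integral_mono)
    show "integrable M (\<lambda>\<omega>. exp (- s * S \<omega>))"
      using nonneg s by (intro integrable_const_bound[where B = 1] AE_I2) auto
    show "integrable M (\<lambda>\<omega>. exp (- s * x) + indicator {\<omega>\<in>space M. S \<omega> < x} \<omega>)"
      by (intro integrable_const_bound[where B = "exp (- s * x) + 1"] AE_I2) (auto simp: indicator_def)
    fix \<omega> assume \<omega>: "\<omega> \<in> space M"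
    show "exp (- s * S \<omega>) \<le> exp (- s * x) + indicator {\<omega>\<in>space M. S \<omega> < x} \<omega>"
    proof (cases "S \<omega> < x")
      case True
      have "exp (- s * S \<omega>) \<le> 1" using nonneg[OF \<omega>] s by simp
      then show ?thesis using True \<omega> by (simp add: add_increasing)
    next
      case False
      then show ?thesis using s \<omega> by (auto simp: mult_left_mono)
    qed
  qed
  also have "\<dots> = exp (- s * x) + prob {\<omega>\<in>space M. S \<omega> < x}"
    by (subst Bochner_Integration.integral_add) (auto simp: prob_space less_top[symmetric])
  finally show ?thesis by simp
qed

text \<open>Markov's inequality for \<open>exp (- s * S)\<close>.\<close>

lemma (in prob_space) prob_greater_ge_laplace:
  fixes S :: "'a \<Rightarrow> real"
  assumes [measurable]: "random_variable borel S" and nonneg: "\<And>\<omega>. \<omega> \<in> space M \<Longrightarrow> 0 \<le> S \<omega>"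
    and s: "0 \<le> s"
  shows "1 - exp (s * x) * expectation (\<lambda>\<omega>. exp (- s * S \<omega>)) \<le> prob {\<omega>\<in>space M. x < S \<omega>}"
proof -
  have int: "integrable M (\<lambda>\<omega>. exp (- s * S \<omega>))"
    using nonneg s by (intro integrable_const_bound[where B = 1] AE_I2) auto
  have "1 - prob {\<omega>\<in>space M. x < S \<omega>} = prob (space M - {\<omega>\<in>space M. x < S \<omega>})"
    by (subst prob_compl) auto
  also have "space M - {\<omega>\<in>space M. x < S \<omega>} = {\<omega>\<in>space M. S \<omega> \<le> x}"
    by auto
  also have "prob {\<omega>\<in>space M. S \<omega> \<le> x} = expectation (\<lambda>\<omega>. indicator {\<omega>\<in>space M. S \<omega> \<le> x} \<omega>)"
    by simp
  also have "\<dots> \<le> expectation (\<lambda>\<omega>. exp (s * x) * exp (- s * S \<omega>))"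
  proof (rule integral_mono)
    show "integrable M (\<lambda>\<omega>. exp (s * x) * exp (- s * S \<omega>))"
      using int by simp
    fix \<omega>
    have "s * S \<omega> \<le> s * x" if "S \<omega> \<le> x"
      using that s by (rule mult_left_mono)
    then show "indicator {\<omega>\<in>space M. S \<omega> \<le> x} \<omega> \<le> exp (s * x) * exp (- s * S \<omega>)"
      by (auto simp: indicator_def simp flip: exp_add)
  qed (auto simp: less_top[symmetric])
  finally show ?thesis by simp
qed


lemma (in prob_space) indep_var_sums_disjoint:
  fixes Z :: "'i \<Rightarrow> 'a \<Rightarrow> real"
  assumes "indep_vars (\<lambda>_. borel) Z I" "A \<inter> B = {}" "A \<subseteq> I" "B \<subseteq> I"
  shows "indep_var borel (\<lambda>\<omega>. \<Sum>i\<in>A. Z i \<omega>) borel (\<lambda>\<omega>. \<Sum>i\<in>B. Z i \<omega>)"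
proof -
  have "indep_var borel ((\<lambda>z. \<Sum>i\<in>A. z i) \<circ> (\<lambda>\<omega>. restrict (\<lambda>i. Z i \<omega>) A))
      borel ((\<lambda>z. \<Sum>i\<in>B. z i) \<circ> (\<lambda>\<omega>. restrict (\<lambda>i. Z i \<omega>) B))"
    by (intro indep_var_compose[OF indep_var_restrict[OF assms]]) auto
  moreover have "(\<lambda>z. \<Sum>i\<in>J. z i) \<circ> (\<lambda>\<omega>. restrict (\<lambda>i. Z i \<omega>) J) = (\<lambda>\<omega>. \<Sum>i\<in>J. Z i \<omega>)" for J
    by (auto intro!: ext sum.cong)
  ultimately show ?thesis by simp
qed

text \<open>With \<open>r = n powr (1 / \<alpha>)\<close>, the transform at \<open>w / r\<close> of
  a sum of \<open>n\<close> waiting times of rate \<open>l\<close> is the reciprocal of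
  \<open>(1 + (w / l) powr \<alpha> / n) ^ n\<close>, which can be bounded uniformly in
  \<open>n\<close>. For \<open>x = b * r\<close> it follows that the \<open>X\<close> sum exceeds
  \<open>2 * x\<close> and the \<open>Y\<close> sum stays below \<open>x\<close> with probabilities
  bounded below. These events are independent, and together they make the difference exceed
  \<open>x\<close>.\<close>

lemma (in prob_space) heavy_tailed_difference_exceeds:
  fixes X Y :: "nat \<Rightarrow> 'a \<Rightarrow> real" and \<alpha> lam \<mu> :: real
  assumes X: "indep_vars (\<lambda>_. borel) X UNIV" "\<And>k \<omega>. \<omega> \<in> space M \<Longrightarrow> 0 \<le> X k \<omega>"
    and Y: "indep_vars (\<lambda>_. borel) Y UNIV" "\<And>k \<omega>. \<omega> \<in> space M \<Longrightarrow> 0 \<le> Y k \<omega>"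
    and XY: "\<And>n. indep_var borel (\<lambda>\<omega>. \<Sum>k<n. X k \<omega>) borel (\<lambda>\<omega>. \<Sum>k<n. Y k \<omega>)"
    and X_laplace: "\<And>k s. 0 < s \<Longrightarrow> expectation (\<lambda>\<omega>. exp (- s * X k \<omega>)) = 1 / (1 + (s / lam) powr \<alpha>)"
    and Y_laplace: "\<And>k s. 0 < s \<Longrightarrow> expectation (\<lambda>\<omega>. exp (- s * Y k \<omega>)) = 1 / (1 + (s / \<mu>) powr \<alpha>)"
    and \<alpha>: "0 < \<alpha>" "\<alpha> < 1" and "0 < lam" "0 < \<mu>"
  obtains c where "0 < c" "\<And>L. \<exists>n. c \<le> prob {\<omega>\<in>space M. L < (\<Sum>k<n. X k \<omega> - Y k \<omega>)}"
proof -
  \<comment> \<open>The 3 gives \<open>(1 + 3 / n) ^ n \<ge> 4\<close> by Bernoulli's inequality,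
    and \<open>b\<close> gives \<open>t / r * (2 * x) = 1\<close>. With \<open>exp 1 \<le> 3\<close>
    the bound for the \<open>X\<close> sum becomes \<open>1 - 3 / 4\<close>.\<close>
  define t where "t = lam * 3 powr (1 / \<alpha>)"
  define b where "b = 1 / (2 * t)"
  have t: "0 < t" "(t / lam) powr \<alpha> = 3"
    using assms by (auto simp: t_def powr_powr)
  have b: "0 < b" using t by (simp add: b_def)
  \<comment> \<open>\<open>u\<close> solves \<open>u * b = 2 * (u / \<mu>) powr \<alpha>\<close>,
    which is possible for all rates because \<open>\<alpha> < 1\<close>. This makes the bound for
    the \<open>Y\<close> sum positive.\<close>
  define v where "v = 2 / (\<mu> powr \<alpha> * b)"
  define u where "u = v powr (1 / (1 - \<alpha>))"
  have v: "0 < v" using b assms by (simp add: v_def)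
  have u: "0 < u" using v by (simp add: u_def)
  have "u powr (1 - \<alpha>) = v" using \<alpha> v by (simp add: u_def powr_powr)
  then have "u = v * u powr \<alpha>"
    using u by (simp add: powr_diff divide_simps split: if_splits)
  then have "u * b = v * u powr \<alpha> * b"
    by (rule arg_cong[where f = "\<lambda>x. x * b"])
  also have "\<dots> = 2 * (u / \<mu>) powr \<alpha>"
    using b u assms(10,11) by (simp add: v_def powr_divide)
  finally have "u * b = 2 * (u / \<mu>) powr \<alpha>" .
  moreover have "0 < (u / \<mu>) powr \<alpha>" using u assms by simp
  ultimately have ub: "(u / \<mu>) powr \<alpha> < u * b" by simp
  define c where "c = (1 / 4) * (exp (- ((u / \<mu>) powr \<alpha>)) - exp (- (u * b)))"
  show ?thesis
  proof (rule that)
    show "0 < c" using ub by (simp add: c_def)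
    fix L :: real
    \<comment> \<open>As \<open>1 / \<alpha> \<ge> 1\<close> and \<open>n \<ge> 1\<close>, the scale
      \<open>r\<close> is at least \<open>n\<close>, so \<open>n \<ge> L / b\<close> ensures
      \<open>x \<ge> L\<close>.\<close>
    define n where "n = nat \<lceil>max 1 (L / b)\<rceil>"
    have "max 1 (L / b) \<le> real n"
      unfolding n_def by (rule real_nat_ceiling_ge)
    then have n1: "1 \<le> real n" and nL: "L / b \<le> real n"
      by auto
    define r where "r = real n powr (1 / \<alpha>)"
    have r: "0 < r" "r powr \<alpha> = n" "real n \<le> r"
      using n1 \<alpha> powr_mono[of 1 "1 / \<alpha>" "real n"] by (auto simp: r_def powr_powr)
    define x where "x = b * r"
    have Lx: "L \<le> x"
      using order_trans[OF nL r(3)] b by (simp add: x_def divide_simps mult.commute)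
    let ?SX = "\<lambda>\<omega>. \<Sum>k<n. X k \<omega>" and ?SY = "\<lambda>\<omega>. \<Sum>k<n. Y k \<omega>"
    have [measurable]: "random_variable borel (X i)" "random_variable borel (Y i)" for i
      using X(1) Y(1) by (auto simp: indep_vars_def)
    have scale: "(w / r / l) powr \<alpha> = (w / l) powr \<alpha> / n" if "0 < w" "0 < l" for w l
      using that r by (simp add: powr_divide powr_mult field_simps)
    have PX: "1 / 4 \<le> prob {\<omega>\<in>space M. 2 * x < ?SX \<omega>}"
    proof -
      have "expectation (\<lambda>\<omega>. exp (- (t / r) * ?SX \<omega>)) = (1 / (1 + 3 / real n)) ^ n"
      proof (rule expectation_exp_sum[OF X])
        show "expectation (\<lambda>\<omega>. exp (- (t / r) * X k \<omega>)) = 1 / (1 + 3 / real n)" for k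
          using t r \<open>0 < lam\<close> by (subst X_laplace) (simp_all only: scale divide_pos_pos)
      qed (use t r in auto)
      also have "\<dots> \<le> 1 / 4"
      proof -
        have "4 \<le> (1 + 3 / real n) ^ n"
          using Bernoulli_inequality[of "3 / real n" n] n1 order_trans[of "- 1" 0 "3 / real n"] by simp
        then show ?thesis by (simp add: power_one_over divide_simps)
      qed
      finally have "exp 1 * expectation (\<lambda>\<omega>. exp (- (t / r) * ?SX \<omega>)) \<le> 3 * (1 / 4)"
        using exp_le by (intro mult_mono) auto
      moreover have tr: "t / r * (2 * x) = 1"
        using t r by (simp add: x_def b_def)
      moreover have "1 - exp (t / r * (2 * x)) * expectation (\<lambda>\<omega>. exp (- (t / r) * ?SX \<omega>))
          \<le> prob {\<omega>\<in>space M. 2 * x < ?SX \<omega>}"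
        using X(2) t r by (intro prob_greater_ge_laplace) (auto intro!: sum_nonneg)
      ultimately show ?thesis
        unfolding tr by linarith
    qed
    have PY: "exp (- ((u / \<mu>) powr \<alpha>)) - exp (- (u * b)) \<le> prob {\<omega>\<in>space M. ?SY \<omega> < x}"
    proof -
      have "exp (- ((u / \<mu>) powr \<alpha>)) \<le> (1 / (1 + (u / \<mu>) powr \<alpha> / real n)) ^ n"
      proof -
        have "(1 + (u / \<mu>) powr \<alpha> / real n) ^ n \<le> exp ((u / \<mu>) powr \<alpha>)"
          using n1 by (intro exp_ge_one_plus_x_over_n_power_n) (auto intro: order_trans[OF _ powr_ge_zero])
        moreover have "0 < (1 + (u / \<mu>) powr \<alpha> / real n) ^ n"
          by (intro zero_less_power add_pos_nonneg) auto
        ultimately show ?thesis by (simp add: power_one_over exp_minus divide_simps)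
      qed
      also have "\<dots> = expectation (\<lambda>\<omega>. exp (- (u / r) * ?SY \<omega>))"
      proof (rule expectation_exp_sum[OF Y, symmetric])
        show "expectation (\<lambda>\<omega>. exp (- (u / r) * Y k \<omega>)) = 1 / (1 + (u / \<mu>) powr \<alpha> / real n)" for k
          using u r \<open>0 < \<mu>\<close> by (subst Y_laplace) (simp_all only: scale divide_pos_pos)
      qed (use u r in auto)
      finally have "exp (- ((u / \<mu>) powr \<alpha>)) \<le> expectation (\<lambda>\<omega>. exp (- (u / r) * ?SY \<omega>))" .
      moreover have ur: "- (u / r) * x = - (u * b)"
        using r by (simp add: x_def)
      moreover have "expectation (\<lambda>\<omega>. exp (- (u / r) * ?SY \<omega>)) - exp (- (u / r) * x)
          \<le> prob {\<omega>\<in>space M. ?SY \<omega> < x}"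
        using Y(2) u r by (intro prob_less_ge_laplace) (auto intro!: sum_nonneg)
      ultimately show ?thesis
        unfolding ur by linarith
    qed
    have "c \<le> prob {\<omega>\<in>space M. 2 * x < ?SX \<omega>} * prob {\<omega>\<in>space M. ?SY \<omega> < x}"
      unfolding c_def using ub by (intro mult_mono PX PY) auto
    also have "\<dots> = prob ((?SX -` {2 * x<..} \<inter> space M) \<inter> (?SY -` {..<x} \<inter> space M))"
      using indep_varD[OF XY[of n], of "{2 * x<..}" "{..<x}"]
      by (simp add: vimage_def Int_def conj_ac)
    also have "\<dots> \<le> prob {\<omega>\<in>space M. L < (\<Sum>k<n. X k \<omega> - Y k \<omega>)}"
      using Lx by (intro finite_measure_mono) (auto simp: sum_subtractf)
    finally show "\<exists>n. c \<le> prob {\<omega>\<in>space M. L < (\<Sum>k<n. X k \<omega> - Y k \<omega>)}" ..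
  qed
qed

text \<open>In the limit the sum exceeds its mean by more than one standard deviation with
  probability \<open>1 - cdf ?N 1\<close>. The mean is nonnegative, and the standard deviation of
  the sum passes every level. The constant \<open>c\<close> is half of this probability, so the
  bound holds for all large \<open>n\<close>.\<close>

lemma (in prob_space) central_limit_sum_exceeds:
  fixes Z :: "nat \<Rightarrow> 'a \<Rightarrow> real"
  assumes indep: "indep_vars (\<lambda>_. borel) Z UNIV"
    and mean: "\<And>n. expectation (Z n) = m" "0 \<le> m"
    and sq: "\<And>n. integrable M (\<lambda>\<omega>. (Z n \<omega>)\<^sup>2)"
    and var: "\<And>n. variance (Z n) = \<sigma>\<^sup>2" "0 < \<sigma>"
    and distr: "\<And>n. distr M borel (Z n) = D"
  obtains c where "0 < c" "\<And>L. \<exists>n. c \<le> prob {\<omega>\<in>space M. L < (\<Sum>k<n. Z k \<omega>)}"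
proof -
  let ?N = std_normal_distribution
  interpret N: real_distribution ?N by (rule real_dist_normal_dist)
  have [measurable]: "random_variable borel (Z i)" for i
    using indep by (auto simp: indep_vars_def)
  define F where "F n = cdf (distr M borel (\<lambda>\<omega>. (\<Sum>i<n. Z i \<omega> - m) / sqrt (real n * \<sigma>\<^sup>2)))" for n
  have "weak_conv_m (\<lambda>n. distr M borel (\<lambda>\<omega>. (\<Sum>i<n. Z i \<omega> - m) / sqrt (real n * \<sigma>\<^sup>2))) ?N"
    by (rule central_limit_theorem[OF indep mean(1) var(2) sq var(1) distr])
  moreover have "isCont (cdf ?N) 1"
  proof -
    have "emeasure ?N {1} = 0"
      by (subst emeasure_density) (auto simp: nn_integral_null_set)
    then show ?thesis by (simp add: N.isCont_cdf measure_def)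
  qed
  ultimately have lim: "(\<lambda>n. F n 1) \<longlonglongrightarrow> cdf ?N 1"
    by (simp add: weak_conv_m_def weak_conv_def F_def)
  define c where "c = (1 - cdf ?N 1) / 2"
  \<comment> \<open>The normal density is positive, so otherwise the half-line \<open>{1<..}\<close>
    would be a Lebesgue null set.\<close>
  have "cdf ?N 1 \<noteq> 1"
  proof
    assume "cdf ?N 1 = 1"
    then have "AE x in ?N. x \<in> {..1}"
      by (simp add: cdf_def N.prob_eq_1)
    then have "AE x in lborel. x \<le> (1::real)"
      by (subst (asm) AE_density) (auto simp: normal_density_pos)
    then have "AE x in lborel. (x::real) \<notin> {1<..}"
      by eventually_elim auto
    then have "emeasure lborel {1::real<..} = 0"
      by (subst (asm) AE_iff_measurable[of "{1<..}"]) auto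
    moreover have "emeasure lborel {1::real<..2} \<le> emeasure lborel {1::real<..}"
      by (intro emeasure_mono) auto
    ultimately show False by simp
  qed
  then have c: "0 < c"
    using N.cdf_bounded_prob[of 1] by (simp add: c_def)
  show ?thesis
  proof (rule that[OF c])
    fix L :: real
    have "eventually (\<lambda>n. F n 1 < 1 - c) sequentially"
      using c by (intro order_tendstoD[OF lim]) (simp add: c_def field_simps)
    then obtain n0 where n0: "\<And>n. n0 \<le> n \<Longrightarrow> F n 1 < 1 - c"
      by (auto simp: eventually_sequentially)
    \<comment> \<open>\<open>n \<ge> (L / \<sigma>)\<^sup>2\<close> makes the standard deviation of
      the sum at least \<open>L\<close>.\<close>
    define n where "n = max n0 (nat \<lceil>max 1 ((L / \<sigma>)\<^sup>2)\<rceil>)"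
    have n: "F n 1 < 1 - c"
      by (rule n0) (simp add: n_def)
    have "max 1 ((L / \<sigma>)\<^sup>2) \<le> real (nat \<lceil>max 1 ((L / \<sigma>)\<^sup>2)\<rceil>)"
      by (rule real_nat_ceiling_ge)
    also have "\<dots> \<le> real n"
      by (simp add: n_def)
    finally have n': "1 \<le> real n" "(L / \<sigma>)\<^sup>2 \<le> real n"
      by auto
    have "L / \<sigma> \<le> sqrt (real n)"
      using n' by (intro real_le_rsqrt)
    then have sL: "L \<le> sqrt (real n * \<sigma>\<^sup>2)"
      using var(2) by (simp add: real_sqrt_mult divide_simps mult.commute)
    have s0: "0 < sqrt (real n * \<sigma>\<^sup>2)"
      using n' var(2) by simp
    let ?T = "\<lambda>\<omega>. (\<Sum>i<n. Z i \<omega> - m) / sqrt (real n * \<sigma>\<^sup>2)"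
    have "F n 1 = prob {\<omega>\<in>space M. ?T \<omega> \<le> 1}"
      unfolding F_def cdf_def by (subst measure_distr) (auto intro!: arg_cong[where f = prob])
    also have "\<dots> = 1 - prob {\<omega>\<in>space M. \<not> ?T \<omega> \<le> 1}"
      using prob_neg[of "\<lambda>\<omega>. ?T \<omega> \<le> 1"] by simp
    finally have "c \<le> prob {\<omega>\<in>space M. \<not> ?T \<omega> \<le> 1}"
      using n by linarith
    also have "\<dots> \<le> prob {\<omega>\<in>space M. L < (\<Sum>k<n. Z k \<omega>)}"
    proof (intro finite_measure_mono subsetI)
      fix \<omega> assume "\<omega> \<in> {\<omega>\<in>space M. \<not> ?T \<omega> \<le> 1}"
      then have "\<omega> \<in> space M" "sqrt (real n * \<sigma>\<^sup>2) < (\<Sum>i<n. Z i \<omega> - m)"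
        using s0 by (auto simp: divide_simps)
      moreover have "(\<Sum>i<n. Z i \<omega> - m) \<le> (\<Sum>i<n. Z i \<omega>)"
        using mean(2) by (intro sum_mono) simp
      ultimately show "\<omega> \<in> {\<omega>\<in>space M. L < (\<Sum>k<n. Z k \<omega>)}"
        using sL by auto
    qed auto
    finally show "\<exists>n. c \<le> prob {\<omega>\<in>space M. L < (\<Sum>k<n. Z k \<omega>)}" ..
  qed
qed

section \<open>Paths of the queue\<close>

lemma epoch_Suc: "epoch x (Suc n) = epoch x n + x n"
  by (simp add: epoch_def)

lemma epoch_0: "epoch x 0 = 0"
  by (simp add: epoch_def)

lemma epoch_mono:
  assumes "\<And>n. 0 \<le> x n" "m \<le> n"
  shows "epoch x m \<le> epoch x n"
  unfolding epoch_def using assms by (intro sum_mono2) auto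

lemma selected_subset:
  assumes "finite W"
  shows "selected c W \<subseteq> W"
proof (cases "W = {}")
  case False
  then have "Min (c ` W) \<in> c ` W"
    using assms by (intro Min_in) auto
  then have "Min {n \<in> W. c n = Min (c ` W)} \<in> {n \<in> W. c n = Min (c ` W)}"
    using assms by (intro Min_in) auto
  then show ?thesis
    by (auto simp: selected_def)
qed (simp add: selected_def)

lemma card_selected_le: "card (selected c W) \<le> 1"
  by (simp add: selected_def)

lemma finite_departed: "finite (departed x y c k)"
  by (induction k) (auto simp: selected_def)

lemma departed_mono: "k \<le> l \<Longrightarrow> departed x y c k \<subseteq> departed x y c l"
  by (rule lift_Suc_mono_le[of "departed x y c"]) auto

text \<open>Unboundedness makes the set in \<open>counting\<close> finite, so that its
  \<open>Max\<close> is a true maximum; nonnegative waiting times make it an initial segment;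
  \<open>0 \<le> t\<close> puts 0 into it.\<close>

lemma le_counting_iff:
  fixes z :: "nat \<Rightarrow> real"
  assumes nonneg: "\<And>n. 0 \<le> z n" and unbounded: "\<And>L::nat. \<exists>n. real L < epoch z n" and "0 \<le> t"
  shows "n \<le> counting z t \<longleftrightarrow> epoch z n \<le> t"
proof -
  obtain N where "real (nat \<lceil>t\<rceil>) < epoch z N"
    using unbounded by blast
  then have N: "t < epoch z N"
    using real_nat_ceiling_ge[of t] by linarith
  have "{n. epoch z n \<le> t} \<subseteq> {..N}"
  proof
    fix n assume "n \<in> {n. epoch z n \<le> t}"
    with N have "epoch z n < epoch z N" by simp
    then have "\<not> N \<le> n"
      using epoch_mono[of z N n] nonneg by fastforce
    then show "n \<in> {..N}" by simp
  qed
  then have fin: "finite {n. epoch z n \<le> t}"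
    by (rule finite_subset) simp
  have ne: "0 \<in> {n. epoch z n \<le> t}"
    using \<open>0 \<le> t\<close> by (simp add: epoch_0)
  then have max: "epoch z (counting z t) \<le> t"
    unfolding counting_def using Max_in[OF fin] by auto
  show ?thesis
  proof
    assume "n \<le> counting z t"
    then have "epoch z n \<le> epoch z (counting z t)"
      by (intro epoch_mono nonneg)
    with max show "epoch z n \<le> t" by simp
  next
    assume "epoch z n \<le> t"
    then show "n \<le> counting z t"
      unfolding counting_def using fin by (intro Max_ge) auto
  qed
qed

text \<open>The almost sure properties of a sample path under which both counting functions are
  genuine. Everything derived here is deterministic.\<close>

locale queue_path =
  fixes x y :: "nat \<Rightarrow> real" and c :: "nat \<Rightarrow> nat"
  assumes x_nonneg: "0 \<le> x n" and y_nonneg: "0 \<le> y n"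
    and x_unbounded: "\<exists>n. real L < epoch x n" and y_unbounded: "\<exists>n. real L < epoch y n"
begin

lemma le_counting_x_iff: "0 \<le> t \<Longrightarrow> n \<le> counting x t \<longleftrightarrow> epoch x n \<le> t"
  using x_nonneg x_unbounded by (rule le_counting_iff)

lemma le_counting_y_iff: "0 \<le> t \<Longrightarrow> n \<le> counting y t \<longleftrightarrow> epoch y n \<le> t"
  using y_nonneg y_unbounded by (rule le_counting_iff)

lemma epoch_x_nonneg: "0 \<le> epoch x n"
  unfolding epoch_def by (intro sum_nonneg x_nonneg)

lemma epoch_y_nonneg: "0 \<le> epoch y n"
  unfolding epoch_def by (intro sum_nonneg y_nonneg)

lemma departed_subset: "departed x y c k \<subseteq> {..<counting x (epoch y k)}"
proof (induction k)
  case (Suc k)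
  have "epoch x (counting x (epoch y k)) \<le> epoch y k"
    using le_counting_x_iff epoch_y_nonneg by blast
  also have "\<dots> \<le> epoch y (Suc k)"
    using y_nonneg by (intro epoch_mono) auto
  finally have "counting x (epoch y k) \<le> counting x (epoch y (Suc k))"
    using le_counting_x_iff epoch_y_nonneg by blast
  moreover have "selected c ({..<counting x (epoch y (Suc k))} - departed x y c k)
      \<subseteq> {..<counting x (epoch y (Suc k))} - departed x y c k"
    by (intro selected_subset) simp
  ultimately show ?case
    using Suc.IH by auto
qed simp

text \<open>
  The last departure jump before the end of the burst has index at most \<open>\<kappa>\<close>, and only jump \<open>\<kappa>\<close> can fall
  inside it, so at most one customer of the burst has left when it ends.
\<close>

lemma queue_upto_after_burst:
  assumes "1 \<le> i" "0 < x m"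
    and class1: "\<And>n. m \<le> n \<Longrightarrow> n < m' \<Longrightarrow> c n = 1"
    and before: "\<And>k. k < \<kappa> \<Longrightarrow> epoch y k \<le> epoch x m"
    and after: "epoch x m' < epoch y (Suc \<kappa>)"
  shows "m' - m - 1 \<le> queue_upto x y c i (epoch x m')"
proof -
  let ?t = "epoch x m'"
  have "\<not> Suc \<kappa> \<le> counting y ?t"
    using after le_counting_y_iff[OF epoch_x_nonneg] by (metis not_le)
  then have sub: "departed x y c (counting y ?t) \<subseteq> departed x y c \<kappa>"
    by (intro departed_mono) simp
  have "card ({m..<m'} \<inter> departed x y c \<kappa>) \<le> 1"
  proof (cases \<kappa>)
    case (Suc k)
    \<comment> \<open>Customer \<open>m\<close> arrives at \<open>epoch x (Suc m)\<close>, strictly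
      after \<open>epoch x m\<close> because \<open>x m\<close> is positive. So no customer of the
      burst has arrived by jump \<open>k\<close>, the one before jump
      \<open>\<kappa>\<close>.\<close>
    have "epoch y k < epoch x (Suc m)"
      using before[of k] Suc \<open>0 < x m\<close> by (simp add: epoch_Suc)
    then have "\<not> Suc m \<le> counting x (epoch y k)"
      using le_counting_x_iff[OF epoch_y_nonneg] by (metis not_le)
    then have "{m..<m'} \<inter> departed x y c k = {}"
      using departed_subset[of k] by auto
    then have "{m..<m'} \<inter> departed x y c \<kappa> \<subseteq>
        selected c ({..<counting x (epoch y (Suc k))} - departed x y c k)"
      using Suc by auto
    then have "card ({m..<m'} \<inter> departed x y c \<kappa>) \<le>
        card (selected c ({..<counting x (epoch y (Suc k))} - departed x y c k))"
      by (intro card_mono) (auto simp: selected_def)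
    also have "\<dots> \<le> 1" by (rule card_selected_le)
    finally show ?thesis .
  qed simp
  then have "m' - m - 1 \<le> card {m..<m'} - card ({m..<m'} \<inter> departed x y c \<kappa>)"
    by simp
  also have "\<dots> = card ({m..<m'} - departed x y c \<kappa>)"
    by (simp add: card_Diff_subset_Int)
  also have "\<dots> \<le> card {n \<in> present x y c ?t. c n = 1}"
  proof (intro card_mono subsetI)
    fix n assume n: "n \<in> {m..<m'} - departed x y c \<kappa>"
    have "m' \<le> counting x ?t"
      using le_counting_x_iff[OF epoch_x_nonneg] by blast
    then show "n \<in> {n \<in> present x y c ?t. c n = 1}"
      using n sub class1 by (auto simp: present_def)
  qed (simp add: present_def)
  also have "\<dots> \<le> queue_upto x y c i ?t"
    unfolding queue_upto_def queue_def using \<open>1 \<le> i\<close>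
    by (intro member_le_sum[where f = "\<lambda>l. card {n \<in> present x y c ?t. c n = l}"]) auto
  finally show ?thesis .
qed

text \<open>If the queue never emptied after \<open>T\<close>, each departure jump beyond some
  \<open>k0\<close> would release a customer, so at least \<open>n\<close> customers would have
  arrived by jump \<open>n + k0\<close>. Overtaking with \<open>m = k0\<close> contradicts
  this.\<close>

lemma queue_empties_if_departures_overtake:
  assumes overtake: "\<And>m. \<exists>n. epoch y (n + m) < epoch x n"
  shows "\<exists>t>T. queue_upto x y c K t = 0"
proof (rule ccontr)
  assume no: "\<not> ?thesis"
  obtain k0 where k0: "real (nat \<lceil>T\<rceil>) < epoch y k0"
    using y_unbounded by blast
  have late: "T < epoch y k" if "k0 \<le> k" for k
  proof -
    have "epoch y k0 \<le> epoch y k"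
      using y_nonneg that by (intro epoch_mono)
    then show ?thesis
      using k0 real_nat_ceiling_ge[of T] by linarith
  qed
  have card: "j \<le> card (departed x y c (k0 + j))" for j
  proof (induction j)
    case (Suc j)
    let ?k = "k0 + j"
    let ?W = "{..<counting x (epoch y (Suc ?k))} - departed x y c ?k"
    \<comment> \<open>An empty \<open>?W\<close> would mean an empty queue at the time of this jump.
      Several jumps may coincide, so \<open>counting y\<close> there is only known to be at least
      \<open>Suc ?k\<close>; monotonicity of \<open>departed\<close> bridges the gap.\<close>
    have "?W \<noteq> {}"
    proof
      assume "?W = {}"
      moreover have "Suc ?k \<le> counting y (epoch y (Suc ?k))"
        using le_counting_y_iff[OF epoch_y_nonneg] by blast
      then have "departed x y c ?k \<subseteq> departed x y c (counting y (epoch y (Suc ?k)))"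
        by (intro departed_mono) simp
      ultimately have "present x y c (epoch y (Suc ?k)) = {}"
        unfolding present_def by blast
      then have "queue_upto x y c K (epoch y (Suc ?k)) = 0"
        by (simp add: queue_upto_def queue_def)
      with no late[of "Suc ?k"] show False by auto
    qed
    then have "card (selected c ?W) = 1"
      by (simp add: selected_def)
    moreover have "departed x y c ?k \<inter> selected c ?W = {}"
      using selected_subset[of ?W c] by auto
    ultimately have "card (departed x y c (Suc ?k)) = card (departed x y c ?k) + 1"
      by (simp add: card_Un_disjoint finite_departed selected_def)
    with Suc show ?case by simp
  qed simp
  obtain n where n: "epoch y (n + k0) < epoch x n"
    using overtake by blast
  have "n \<le> card (departed x y c (k0 + n))" by (rule card)
  also have "\<dots> \<le> card {..<counting x (epoch y (k0 + n))}"
    by (intro card_mono departed_subset) simp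
  finally have "epoch x n \<le> epoch y (k0 + n)"
    using le_counting_x_iff[OF epoch_y_nonneg] by simp
  with n show False
    by (simp add: add.commute)
qed

end

lemma Limsup_at_top_nat_eq_infinity:
  fixes f :: "real \<Rightarrow> nat"
  assumes "\<And>(m::nat) T. \<exists>t>T. m \<le> f t"
  shows "Limsup at_top (\<lambda>t. ereal (real (f t))) = \<infinity>"
proof (rule ereal_top)
  fix B :: real
  show "ereal B \<le> Limsup at_top (\<lambda>t. ereal (real (f t)))"
    unfolding Limsup_def
  proof (rule INF_greatest)
    fix P :: "real \<Rightarrow> bool" assume "P \<in> {P. eventually P at_top}"
    then obtain T where T: "\<And>t. T \<le> t \<Longrightarrow> P t"
      by (auto simp: eventually_at_top_linorder)
    obtain t where t: "T < t" "nat \<lceil>B\<rceil> \<le> f t"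
      using assms by blast
    then have "B \<le> real (f t)"
      using real_nat_ceiling_ge[of B] by linarith
    then show "ereal B \<le> (SUP t\<in>Collect P. ereal (real (f t)))"
      using T[of t] t by (intro SUP_upper2[of t]) auto
  qed
qed

section \<open>Bursts of arrivals\<close>

text \<open>
  Padding with zeros instead of \<open>undefined\<close> keeps the waiting times nonnegative.
\<close>

definition zero_outside :: "'i set \<Rightarrow> ('i \<Rightarrow> real) \<Rightarrow> 'i \<Rightarrow> real" where
  "zero_outside I z = (\<lambda>i. if i \<in> I then z i else 0)"

text \<open>The padded family depends only on the coordinates in \<open>I\<close>, which are
  independent of those in \<open>F\<close>. Padding lets \<open>\<Phi>\<close> be a predicate on
  full families even though it is evaluated on the past.\<close>

lemma (in prob_space) prob_past_and_fresh:
  fixes Z :: "'i \<Rightarrow> 'a \<Rightarrow> real"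
  assumes indep: "indep_vars (\<lambda>_. borel) Z UNIV"
    and disj: "I \<inter> F = {}" and F: "finite F" "F \<noteq> {}"
    and \<Phi>[measurable]: "Measurable.pred (Pi\<^sub>M UNIV (\<lambda>_. borel)) \<Phi>"
    and B: "\<And>i. B i \<in> sets borel"
  shows "\<P>(\<omega> in M. \<Phi> (zero_outside I (\<lambda>i. Z i \<omega>)) \<and> (\<forall>i\<in>F. Z i \<omega> \<in> B i)) =
      \<P>(\<omega> in M. \<Phi> (zero_outside I (\<lambda>i. Z i \<omega>))) * (\<Prod>i\<in>F. \<P>(\<omega> in M. Z i \<omega> \<in> B i))"
proof -
  let ?P = "\<lambda>J. Pi\<^sub>M J (\<lambda>_. borel :: real measure)"
  let ?U = "\<lambda>J \<omega>. restrict (\<lambda>i. Z i \<omega>) J"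
  have "(\<lambda>z. if i \<in> I then z i else 0) \<in> borel_measurable (?P I)" for i
    by (cases "i \<in> I") auto
  then have [measurable]: "zero_outside I \<in> measurable (?P I) (?P UNIV)"
    unfolding zero_outside_def by (rule measurable_PiM_single') (auto simp: space_PiM)
  define A where "A = {u \<in> space (?P I). \<Phi> (zero_outside I u)}"
  have A: "A \<in> sets (?P I)"
    unfolding A_def by measurable
  have BF: "Pi\<^sub>E F B \<in> sets (?P F)"
    using F B by (intro sets_PiM_I_finite) auto
  have "indep_var (?P I) (?U I) (?P F) (?U F)"
    using disj by (intro indep_var_restrict[OF indep]) auto
  note indep_varD[OF this A BF]
  moreover have "?U I -` A \<inter> space M = {\<omega>\<in>space M. \<Phi> (zero_outside I (\<lambda>i. Z i \<omega>))}"
  proof -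
    have "zero_outside I (?U I \<omega>) = zero_outside I (\<lambda>i. Z i \<omega>)" for \<omega>
      by (auto simp: zero_outside_def)
    then show ?thesis
      by (auto simp: A_def space_PiM)
  qed
  moreover have UF: "?U F -` Pi\<^sub>E F B \<inter> space M = {\<omega>\<in>space M. \<forall>i\<in>F. Z i \<omega> \<in> B i}"
    by (auto simp: PiE_iff)
  moreover have "prob {\<omega>\<in>space M. \<forall>i\<in>F. Z i \<omega> \<in> B i} = (\<Prod>i\<in>F. \<P>(\<omega> in M. Z i \<omega> \<in> B i))"
  proof -
    have "prob (\<Inter>i\<in>F. Z i -` B i \<inter> space M) = (\<Prod>i\<in>F. prob (Z i -` B i \<inter> space M))"
      using F B by (intro indep_varsD[OF indep]) auto
    moreover have "(\<Inter>i\<in>F. Z i -` B i \<inter> space M) = {\<omega>\<in>space M. \<forall>i\<in>F. Z i \<omega> \<in> B i}"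
      using F by auto
    moreover have "Z i -` B i \<inter> space M = {\<omega>\<in>space M. Z i \<omega> \<in> B i}" for i
      by auto
    ultimately show ?thesis by simp
  qed
  moreover have "(\<lambda>\<omega>. (?U I \<omega>, ?U F \<omega>)) -` (A \<times> Pi\<^sub>E F B) \<inter> space M =
     {\<omega>\<in>space M. \<Phi> (zero_outside I (\<lambda>i. Z i \<omega>)) \<and> (\<forall>i\<in>F. Z i \<omega> \<in> B i)}"
    using calculation(2) UF by auto
  ultimately show ?thesis
    by (auto simp: vimage_def Int_def conj_ac)
qed

context
  fixes r :: nat and \<delta> :: real
begin

text \<open>Customers are grouped in blocks of \<open>r\<close>, block \<open>j\<close> starting at
  arrival epoch \<open>r * j\<close>. Departure jumps are counted from 1, so waiting time
  \<open>k\<close> is the one that follows jump \<open>k\<close>.\<close>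

definition first_departure :: "(nat + nat + nat \<Rightarrow> real) \<Rightarrow> nat \<Rightarrow> nat \<Rightarrow> bool" where
  "first_departure z j k \<longleftrightarrow>
     epoch (\<lambda>n. z (Inl n)) (r * j) < epoch (\<lambda>n. z (Inr (Inl n))) k \<and>
     (\<forall>k'<k. epoch (\<lambda>n. z (Inr (Inl n))) k' \<le> epoch (\<lambda>n. z (Inl n)) (r * j))"

definition tight :: "(nat + nat + nat \<Rightarrow> real) \<Rightarrow> nat \<Rightarrow> bool" where
  "tight z j \<longleftrightarrow> (\<forall>n\<in>{r * j..<r * Suc j}. z (Inl n) \<le> \<delta> \<and> z (Inr (Inr n)) = 1)"

definition burst :: "(nat + nat + nat \<Rightarrow> real) \<Rightarrow> nat \<Rightarrow> bool" where
  "burst z j \<longleftrightarrow> tight z j \<and> (\<exists>k. first_departure z j k \<and>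
     epoch (\<lambda>n. z (Inl n)) (r * Suc j) < epoch (\<lambda>n. z (Inr (Inl n))) (Suc k))"

text \<open>The inputs observed up to the start of block \<open>j\<close> and, for departures, up to
  jump \<open>k\<close>. Waiting time \<open>k\<close> is left out and so remains fresh.\<close>

definition past :: "nat \<Rightarrow> nat \<Rightarrow> (nat + nat + nat) set" where
  "past j k = Inl ` {..<r * j} \<union> Inr ` Inl ` {..<k} \<union> Inr ` Inr ` {..<r * j}"

text \<open>
  Given that departure \<open>k\<close> is the first one after the start of block \<open>j\<close>, whether an earlier
  block was a burst does not involve the waiting time \<open>k\<close>: if \<open>k\<close> was already the next departure
  at the start of an earlier block, then no departure falls into that block at all. This is why
  \<open>burst\<close> asks for few departures in the block instead of a long waiting time.
\<close>

definition quiet :: "nat \<Rightarrow> nat \<Rightarrow> nat \<Rightarrow> (nat + nat + nat \<Rightarrow> real) \<Rightarrow> bool" where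
  "quiet J j k z \<longleftrightarrow> (\<forall>i\<in>{J..<j}. \<not> burst z i) \<and> first_departure z j k"

text \<open>Absence of earlier bursts transfers by contraposition: a burst of \<open>z'\<close> in a
  block \<open>i < j\<close>, with next departure \<open>k'\<close>, is also one of
  \<open>z\<close>. Here \<open>k' \<le> k\<close> because epochs are monotone.\<close>

lemma quiet_depends_on_past:
  assumes agree: "\<And>i. i \<in> past j k \<Longrightarrow> z i = z' i"
    and nonneg: "\<And>n. 0 \<le> z (Inl n)" "\<And>n. 0 \<le> z (Inr (Inl n))"
      "\<And>n. 0 \<le> z' (Inl n)" "\<And>n. 0 \<le> z' (Inr (Inl n))"
    and quiet: "quiet J j k z"
  shows "quiet J j k z'"
proof -
  let ?S = "\<lambda>z. epoch (\<lambda>n. z (Inl n)) :: nat \<Rightarrow> real" and ?T = "\<lambda>z. epoch (\<lambda>n. z (Inr (Inl n))) :: nat \<Rightarrow> real"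
  have S: "?S z n = ?S z' n" if "n \<le> r * j" for n
    unfolding epoch_def using that by (intro sum.cong agree) (auto simp: past_def)
  have T: "?T z n = ?T z' n" if "n \<le> k" for n
    unfolding epoch_def using that by (intro sum.cong agree) (auto simp: past_def)
  have fd: "first_departure z j k"
    using quiet by (simp add: quiet_def)
  have fd': "first_departure z' j k"
    using fd S[of "r * j"] T by (simp add: first_departure_def)
  have "burst z i" if "burst z' i" "i < j" for i
  proof -
    have ij: "r * Suc i \<le> r * j"
      using \<open>i < j\<close> by (intro mult_le_mono2) simp
    then have ij': "r * i \<le> r * j"
      using \<open>i < j\<close> by simp
    obtain k' where k': "first_departure z' i k'" "?S z' (r * Suc i) < ?T z' (Suc k')"
      using \<open>burst z' i\<close> by (auto simp: burst_def)
    have Sij: "?S z' (r * Suc i) \<le> ?S z' (r * j)" "?S z' (r * i) \<le> ?S z' (r * j)"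
      using ij ij' nonneg by (auto intro!: epoch_mono)
    have "k' \<le> k"
    proof (rule ccontr)
      assume "\<not> k' \<le> k"
      then have "?T z' k \<le> ?S z' (r * i)"
        using k' by (simp add: first_departure_def)
      with fd' Sij show False by (simp add: first_departure_def)
    qed
    have "first_departure z i k'"
      using k'(1) S[OF ij'] T \<open>k' \<le> k\<close> by (simp add: first_departure_def)
    moreover have "?S z (r * Suc i) < ?T z (Suc k')"
    \<comment> \<open>For \<open>k' < k\<close> the epoch \<open>Suc k'\<close> is still determined
      by the past. For \<open>k' = k\<close> it is not, but then jump \<open>k\<close> comes after
      the start of block \<open>j\<close>, hence after the end of block \<open>i\<close>.\<close>
    proof (cases "k' = k")
      case True
      have "?S z (r * Suc i) \<le> ?S z (r * j)"
        using ij nonneg by (intro epoch_mono)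
      also have "\<dots> < ?T z k"
        using fd by (simp add: first_departure_def)
      also have "\<dots> \<le> ?T z (Suc k')"
        using True nonneg by (intro epoch_mono) auto
      finally show ?thesis .
    next
      case False
      then show ?thesis
        using k'(2) S[OF ij] T[of "Suc k'"] \<open>k' \<le> k\<close> by simp
    qed
    moreover have "tight z i"
    proof -
      have "z (Inl n) = z' (Inl n)" "z (Inr (Inr n)) = z' (Inr (Inr n))" if "n < r * Suc i" for n
        using that ij by (auto intro!: agree simp: past_def)
      then show ?thesis
        using \<open>burst z' i\<close> by (auto simp: burst_def tight_def)
    qed
    ultimately show ?thesis
      by (auto simp: burst_def)
  qed
  then show ?thesis
    using quiet fd' by (auto simp: quiet_def)
qed

lemma measurable_epochs [measurable]:
  "(\<lambda>z. epoch (\<lambda>n. z (Inl n)) k) \<in> borel_measurable (Pi\<^sub>M UNIV (\<lambda>_. borel :: real measure))"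
  "(\<lambda>z. epoch (\<lambda>n. z (Inr (Inl n))) k) \<in> borel_measurable (Pi\<^sub>M UNIV (\<lambda>_. borel :: real measure))"
  unfolding epoch_def by measurable

lemma pred_first_departure [measurable]:
  "Measurable.pred (Pi\<^sub>M UNIV (\<lambda>_. borel)) (\<lambda>z. first_departure z j k)"
  unfolding first_departure_def not_less[symmetric]
  by (intro pred_intros_logic(2,3) pred_intros_countable(1) pred_intros_imp'
        borel_measurable_pred_less measurable_epochs)

lemma pred_tight [measurable]:
  "Measurable.pred (Pi\<^sub>M UNIV (\<lambda>_. borel)) (\<lambda>z. tight z j)"
  unfolding tight_def Ball_def by measurable

lemma pred_burst [measurable]:
  "Measurable.pred (Pi\<^sub>M UNIV (\<lambda>_. borel)) (\<lambda>z. burst z j)"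
  unfolding burst_def by measurable

lemma pred_quiet [measurable]:
  "Measurable.pred (Pi\<^sub>M UNIV (\<lambda>_. borel)) (quiet J j k)"
  unfolding quiet_def Ball_def by measurable

end

text \<open>Up to a null set, the event of no burst in the blocks from \<open>J\<close> to
  \<open>j - 1\<close> splits into disjoint pieces according to the next departure \<open>k\<close>.
  On each piece a proportion of at least \<open>q\<close> has a burst in block \<open>j\<close>, so
  the probability of no burst decays geometrically.\<close>

lemma (in prob_space) AE_infinitely_many_bursts:
  fixes X Y C :: "nat \<Rightarrow> 'a \<Rightarrow> real" and \<eta> \<delta> \<epsilon> :: real
  defines "Z \<equiv> case_sum X (case_sum Y C)"
  assumes indep: "indep_vars (\<lambda>_. borel) Z UNIV"
    and nonneg: "\<And>n \<omega>. \<omega> \<in> space M \<Longrightarrow> 0 \<le> X n \<omega>" "\<And>n \<omega>. \<omega> \<in> space M \<Longrightarrow> 0 \<le> Y n \<omega>"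
    and unbounded: "AE \<omega> in M. \<forall>L::nat. \<exists>n. real L < epoch (\<lambda>n. Y n \<omega>) n"
    and \<eta>: "0 < \<eta>" and r\<delta>: "r * \<delta> \<le> \<epsilon>"
    and X: "\<And>n. \<eta> \<le> \<P>(\<omega> in M. X n \<omega> \<le> \<delta>)"
    and Y: "\<And>n. \<eta> \<le> \<P>(\<omega> in M. \<epsilon> < Y n \<omega>)"
    and C: "\<And>n. \<eta> \<le> \<P>(\<omega> in M. C n \<omega> = 1)"
  shows "AE \<omega> in M. \<forall>J. \<exists>j\<ge>J. burst r \<delta> (\<lambda>i. Z i \<omega>) j"
proof -
  let ?z = "\<lambda>\<omega> i. Z i \<omega>"
  have Zsimps [simp]: "Z (Inl n) = X n" "Z (Inr (Inl n)) = Y n" "Z (Inr (Inr n)) = C n" for n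
    by (simp_all add: Z_def)
  have [measurable]: "random_variable borel (Z i)" for i
    using indep by (auto simp: indep_vars_def)
  have z [measurable]: "?z \<in> measurable M (Pi\<^sub>M UNIV (\<lambda>_. borel))"
    by (rule measurable_PiM_single') (auto simp: space_PiM)
  define Q where "Q J j k = {\<omega>\<in>space M. quiet r \<delta> J j k (?z \<omega>)}" for J j k
  define N where "N J j = {\<omega>\<in>space M. \<forall>i\<in>{J..<j}. \<not> burst r \<delta> (?z \<omega>) i}" for J j
  define W where "W j = {\<omega>\<in>space M. burst r \<delta> (?z \<omega>) j}" for j
  have [measurable]: "Q J j k \<in> events" for J j k
    unfolding Q_def by measurable
  have [measurable]: "N J j \<in> events" for J j
    unfolding N_def by measurable
  have [measurable]: "W j \<in> events" for j
    unfolding W_def by measurable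
  define B :: "nat + nat + nat \<Rightarrow> real set" where
    "B = case_sum (\<lambda>n. {..\<delta>}) (case_sum (\<lambda>n. {\<epsilon><..}) (\<lambda>n. {1}))"
  have B: "B i \<in> sets borel" for i
    by (auto simp: B_def split: sum.splits)
  have PB: "\<eta> \<le> \<P>(\<omega> in M. Z i \<omega> \<in> B i)" for i
    using X Y C by (auto simp: B_def split: sum.splits)
  have \<eta>1: "\<eta> \<le> 1"
    using X[of 0] prob_le_1 order_trans by blast
  \<comment> \<open>One factor for each of the \<open>r\<close> short interarrival times and the
    \<open>r\<close> classes, and one for the long waiting time.\<close>
  define q where "q = \<eta> ^ (2 * r + 1)"
  have q: "0 < q" "q \<le> 1"
    unfolding q_def using \<eta> \<eta>1 by (auto intro!: power_le_one simp del: power_Suc power_Suc2)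
  have step: "prob (Q J j k) * q \<le> prob (Q J j k \<inter> W j)" for J j k
  proof -
    define F :: "(nat + nat + nat) set" where
      "F = Inl ` {r * j..<r * Suc j} \<union> {Inr (Inl k)} \<union> Inr ` Inr ` {r * j..<r * Suc j}"
    have F: "finite F" "F \<noteq> {}" "past r j k \<inter> F = {}"
      by (auto simp: F_def past_def)
    have "card F \<le> card (Inl ` {r * j..<r * Suc j} \<union> {Inr (Inl k)} :: (nat + nat + nat) set) +
        card (Inr ` Inr ` {r * j..<r * Suc j} :: (nat + nat + nat) set)"
      unfolding F_def by (rule card_Un_le)
    also have "\<dots> \<le> (card (Inl ` {r * j..<r * Suc j} :: (nat + nat + nat) set) + card {Inr (Inl k) :: nat + nat + nat}) +
        card (Inr ` Inr ` {r * j..<r * Suc j} :: (nat + nat + nat) set)"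
      by (intro add_right_mono card_Un_le)
    also have "\<dots> \<le> 2 * r + 1"
      by (simp add: card_image image_image inj_on_def)
    finally have "card F \<le> 2 * r + 1" .
    then have "q \<le> \<eta> ^ card F"
      unfolding q_def using \<eta> \<eta>1 by (intro power_decreasing) auto
    also have "\<dots> = (\<Prod>i\<in>F. \<eta>)" by simp
    also have "\<dots> \<le> (\<Prod>i\<in>F. \<P>(\<omega> in M. Z i \<omega> \<in> B i))"
      using PB \<eta> by (intro prod_mono) (auto intro: less_imp_le)
    finally have qF: "q \<le> (\<Prod>i\<in>F. \<P>(\<omega> in M. Z i \<omega> \<in> B i))" .
    have restrict: "quiet r \<delta> J j k (zero_outside (past r j k) (?z \<omega>)) \<longleftrightarrow> quiet r \<delta> J j k (?z \<omega>)"
      if "\<omega> \<in> space M" for \<omega>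
    proof
      assume "quiet r \<delta> J j k (zero_outside (past r j k) (?z \<omega>))"
      then show "quiet r \<delta> J j k (?z \<omega>)"
        by (rule quiet_depends_on_past[rotated -1]) (use nonneg that in \<open>auto simp: zero_outside_def\<close>)
    next
      assume "quiet r \<delta> J j k (?z \<omega>)"
      then show "quiet r \<delta> J j k (zero_outside (past r j k) (?z \<omega>))"
        by (rule quiet_depends_on_past[rotated -1]) (use nonneg that in \<open>auto simp: zero_outside_def\<close>)
    qed
    have "prob (Q J j k) * q \<le> prob (Q J j k) * (\<Prod>i\<in>F. \<P>(\<omega> in M. Z i \<omega> \<in> B i))"
      by (intro mult_left_mono qF) simp
    also have "\<dots> = \<P>(\<omega> in M. quiet r \<delta> J j k (zero_outside (past r j k) (?z \<omega>))) *
        (\<Prod>i\<in>F. \<P>(\<omega> in M. Z i \<omega> \<in> B i))"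
      unfolding Q_def by (simp add: restrict cong: conj_cong)
    also have "\<dots> = \<P>(\<omega> in M. quiet r \<delta> J j k (zero_outside (past r j k) (?z \<omega>)) \<and> (\<forall>i\<in>F. Z i \<omega> \<in> B i))"
      using F B by (intro prob_past_and_fresh[symmetric] indep) auto
    also have "\<dots> \<le> prob (Q J j k \<inter> W j)"
    proof (intro finite_measure_mono subsetI)
      fix \<omega> assume "\<omega> \<in> {\<omega>\<in>space M. quiet r \<delta> J j k (zero_outside (past r j k) (?z \<omega>)) \<and> (\<forall>i\<in>F. Z i \<omega> \<in> B i)}"
      then have \<omega>: "\<omega> \<in> space M" "quiet r \<delta> J j k (?z \<omega>)" and fresh: "\<And>i. i \<in> F \<Longrightarrow> Z i \<omega> \<in> B i"
        using restrict by auto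
      have tight: "X n \<omega> \<le> \<delta>" "C n \<omega> = 1" if "n \<in> {r * j..<r * Suc j}" for n
        using fresh[of "Inl n"] fresh[of "Inr (Inr n)"] that by (auto simp: F_def B_def)
      have "\<epsilon> < Y k \<omega>"
        using fresh[of "Inr (Inl k)"] by (auto simp: F_def B_def)
      have fd: "first_departure r (?z \<omega>) j k"
        using \<omega> by (simp add: quiet_def)
      \<comment> \<open>The block starts before jump \<open>k\<close> and lasts at most
        \<open>r * \<delta> \<le> \<epsilon>\<close>, less than the waiting time after jump
        \<open>k\<close>, so it ends before jump \<open>Suc k\<close>.\<close>
      have "epoch (\<lambda>n. X n \<omega>) (r * Suc j) = epoch (\<lambda>n. X n \<omega>) (r * j) + (\<Sum>n=r * j..<r * Suc j. X n \<omega>)"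
        unfolding epoch_def by (simp add: lessThan_atLeast0 sum.atLeastLessThan_concat)
      also have "(\<Sum>n=r * j..<r * Suc j. X n \<omega>) \<le> (\<Sum>n=r * j..<r * Suc j. \<delta>)"
        by (intro sum_mono tight)
      also have "\<dots> \<le> \<epsilon>"
        using r\<delta> by simp
      also have "epoch (\<lambda>n. X n \<omega>) (r * j) < epoch (\<lambda>n. Y n \<omega>) k"
        using fd by (simp add: first_departure_def)
      also have "epoch (\<lambda>n. Y n \<omega>) k + \<epsilon> < epoch (\<lambda>n. Y n \<omega>) (Suc k)"
        using \<open>\<epsilon> < Y k \<omega>\<close> by (simp add: epoch_Suc)
      finally have "epoch (\<lambda>n. X n \<omega>) (r * Suc j) < epoch (\<lambda>n. Y n \<omega>) (Suc k)" by simp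
      with fd tight have "burst r \<delta> (?z \<omega>) j"
        by (auto simp: burst_def tight_def)
      with \<omega> show "\<omega> \<in> Q J j k \<inter> W j"
        by (simp add: Q_def W_def)
    qed simp
    finally show ?thesis .
  qed
  have AE_first: "AE \<omega> in M. \<exists>k. first_departure r (?z \<omega>) j k" for j
    using unbounded
  proof eventually_elim
    case (elim \<omega>)
    let ?P = "\<lambda>k. epoch (\<lambda>n. X n \<omega>) (r * j) < epoch (\<lambda>n. Y n \<omega>) k"
    obtain k where "real (nat \<lceil>epoch (\<lambda>n. X n \<omega>) (r * j)\<rceil>) < epoch (\<lambda>n. Y n \<omega>) k"
      using elim by blast
    then have "?P k"
      using real_nat_ceiling_ge[of "epoch (\<lambda>n. X n \<omega>) (r * j)"] by linarith
    then have "?P (LEAST k. ?P k)"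
      by (rule LeastI)
    moreover have "\<forall>k'<(LEAST k. ?P k). epoch (\<lambda>n. Y n \<omega>) k' \<le> epoch (\<lambda>n. X n \<omega>) (r * j)"
      by (intro allI impI leI) (rule not_less_Least)
    ultimately have "first_departure r (?z \<omega>) j (LEAST k. ?P k)"
      unfolding first_departure_def Zsimps by (rule conjI)
    then show ?case ..
  qed
  have first_unique: "k = k'" if "first_departure r (?z \<omega>) j k" "first_departure r (?z \<omega>) j k'" for \<omega> j k k'
    using that by (cases k k' rule: linorder_cases) (force simp: first_departure_def)+
  have decay: "prob (N J (Suc j)) \<le> (1 - q) * prob (N J j)" if "J \<le> j" for J j
  proof -
    have disj: "disjoint_family (Q J j)"
      using first_unique by (auto simp: disjoint_family_on_def Q_def quiet_def)
    have UN: "prob (\<Union>k. Q J j k) = prob (N J j)"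
    proof (rule finite_measure_eq_AE)
      show "AE \<omega> in M. (\<omega> \<in> (\<Union>k. Q J j k)) = (\<omega> \<in> N J j)"
        using AE_first[of j] by eventually_elim (auto simp: Q_def N_def quiet_def)
    qed auto
    have "(\<lambda>k. prob (Q J j k)) sums prob (\<Union>k. Q J j k)"
      using disj by (intro finite_measure_UNION) auto
    then have s1: "(\<lambda>k. prob (Q J j k) * q) sums (prob (N J j) * q)"
      unfolding UN by (rule sums_mult2)
    have s2: "(\<lambda>k. prob (Q J j k \<inter> W j)) sums prob (\<Union>k. Q J j k \<inter> W j)"
      using disj by (intro finite_measure_UNION) (auto simp: disjoint_family_on_def)
    have "prob (N J j) * q \<le> prob (\<Union>k. Q J j k \<inter> W j)"
      by (rule sums_le[OF step s1 s2])
    also have "\<dots> \<le> prob (N J j - N J (Suc j))"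
      using that by (intro finite_measure_mono) (auto simp: Q_def N_def W_def quiet_def)
    also have "\<dots> = prob (N J j) - prob (N J (Suc j))"
      by (intro finite_measure_Diff) (auto simp: N_def)
    finally show ?thesis
      by (simp add: algebra_simps)
  qed
  have geometric: "prob (N J (J + n)) \<le> (1 - q) ^ n" for J n
  proof (induction n)
    case (Suc n)
    have "prob (N J (Suc (J + n))) \<le> (1 - q) * prob (N J (J + n))"
      by (rule decay) simp
    also have "\<dots> \<le> (1 - q) * (1 - q) ^ n"
      using q by (intro mult_left_mono Suc.IH) auto
    finally show ?case by simp
  qed simp
  have "AE \<omega> in M. \<exists>j\<ge>J. burst r \<delta> (?z \<omega>) j" for J
  proof -
    let ?E = "{\<omega>\<in>space M. \<forall>j\<ge>J. \<not> burst r \<delta> (?z \<omega>) j}"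
    have "prob ?E \<le> (1 - q) ^ n" for n
    proof -
      have "prob ?E \<le> prob (N J (J + n))"
        by (intro finite_measure_mono) (auto simp: N_def)
      also have "\<dots> \<le> (1 - q) ^ n" by (rule geometric)
      finally show ?thesis .
    qed
    moreover have "(\<lambda>n. (1 - q) ^ n) \<longlonglongrightarrow> 0"
      using q by (intro LIMSEQ_realpow_zero) auto
    ultimately have "prob ?E \<le> 0"
      by (intro LIMSEQ_le_const) auto
    then have "prob ?E = 0"
      using measure_nonneg[of M ?E] by linarith
    then have "AE \<omega> in M. \<omega> \<notin> ?E"
      by (intro AE_iff_measurable[THEN iffD2, of ?E]) (auto simp: emeasure_eq_measure)
    then show ?thesis
      by (auto elim!: AE_mp)
  qed
  then show ?thesis
    by (simp add: AE_all_countable)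
qed

section \<open>Queues with equal indices\<close>

lemma (in prob_space) indep_vars_functions_of_blocks:
  assumes "indep_vars N Z UNIV" "disjoint_family_on K L"
    and "\<And>k. k \<in> L \<Longrightarrow> g k \<in> measurable (Pi\<^sub>M (K k) N) (N' k)"
  shows "indep_vars N' (\<lambda>k \<omega>. g k (restrict (\<lambda>i. Z i \<omega>) (K k))) L"
  using assms
  by (intro indep_vars_compose2[where M' = "\<lambda>k. Pi\<^sub>M (K k) N" and Y = g] indep_vars_restrict) auto

text \<open>Some power \<open>l ^ n\<close> is so small that the exponential bound gives probability
  at least 1 / 2 of exceeding \<open>L\<close>. The 0-1 law does the rest.\<close>

lemma (in prob_space) AE_epochs_unbounded:
  fixes X :: "nat \<Rightarrow> 'a \<Rightarrow> real"
  assumes indep: "indep_vars (\<lambda>_. borel) X UNIV"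
    and nonneg: "\<And>k \<omega>. \<omega> \<in> space M \<Longrightarrow> 0 \<le> X k \<omega>" and s: "0 < s"
    and laplace: "\<And>k. expectation (\<lambda>\<omega>. exp (- s * X k \<omega>)) = l" and l: "l < 1"
  shows "AE \<omega> in M. \<forall>L::nat. \<exists>n. real L < epoch (\<lambda>k. X k \<omega>) n"
proof -
  have [measurable]: "random_variable borel (X i)" for i
    using indep by (auto simp: indep_vars_def)
  have "AE \<omega> in M. \<forall>L::nat. \<exists>n. real L < (\<Sum>k<n. X k \<omega>)"
  proof (rule AE_unbounded_partial_sums[OF indep, of "1 / 2"])
    fix L :: real
    obtain n where "l ^ n < 1 / (2 * exp (s * L))"
      using real_arch_pow_inv[OF _ l, of "1 / (2 * exp (s * L))"] by auto
    then have "1 / 2 \<le> 1 - exp (s * L) * l ^ n"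
      by (simp add: field_simps)
    also have "\<dots> = 1 - exp (s * L) * expectation (\<lambda>\<omega>. exp (- s * (\<Sum>k<n. X k \<omega>)))"
      using s by (subst expectation_exp_sum[OF indep nonneg _ laplace]) auto
    also have "\<dots> \<le> prob {\<omega>\<in>space M. L < (\<Sum>k<n. X k \<omega>)}"
      using s nonneg by (intro prob_greater_ge_laplace) (auto intro!: sum_nonneg)
    finally show "\<exists>n. 1 / 2 \<le> prob {\<omega>\<in>space M. L < (\<Sum>k<n. X k \<omega>)}" ..
  qed simp
  then show ?thesis by (simp add: epoch_def)
qed

lemma mittag_leffler_one: "mittag_leffler 1 z = exp z"
proof -
  have "Gamma (1 + 1 * real l) = fact l" for l
    using Gamma_fact[of l, where 'a = real] by simp
  then show ?thesis
    by (simp add: mittag_leffler_def exp_def divide_inverse scaleR_conv_of_real mult.commute)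
qed

lemma mittag_leffler_0: "mittag_leffler \<theta> 0 = 1"
proof -
  have "(\<lambda>l. 0 ^ l / Gamma (1 + \<theta> * real l)) = (\<lambda>l. if l = 0 then 1 else 0)"
    by (auto simp: fun_eq_iff)
  then show ?thesis
    using sums_single[of 0 "\<lambda>_. 1 :: real"] by (simp add: mittag_leffler_def sums_iff)
qed

locale equal_index_queue = mittag_leffler_queue +
  assumes \<alpha>_eq: "\<beta> = \<alpha>" and \<alpha>: "0 < \<alpha>" "\<alpha> \<le> 1" and lam: "0 < lam" and \<mu>: "0 < \<mu>"
    and K: "1 \<le> K" and p1: "0 < p 1"
begin

abbreviation Z :: "nat + nat + nat \<Rightarrow> 'a \<Rightarrow> real" where
  "Z \<equiv> case_sum X (case_sum Y (\<lambda>n \<omega>. real (C n \<omega>)))"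

section \<open>Independence and Laplace transforms of the inputs\<close>

lemma measurable_inputs [measurable]:
  "random_variable borel (X n)" "random_variable borel (Y n)" "random_variable borel (\<lambda>\<omega>. real (C n \<omega>))"
proof -
  have "random_variable borel (Z i)" for i
    using indep by (auto simp: indep_vars_def)
  from this[of "Inl n"] this[of "Inr (Inl n)"] this[of "Inr (Inr n)"]
  show "random_variable borel (X n)" "random_variable borel (Y n)" "random_variable borel (\<lambda>\<omega>. real (C n \<omega>))"
    by simp_all
qed

lemma indep_X: "indep_vars (\<lambda>_. borel) X UNIV"
  using indep_vars_functions_of_blocks[OF indep, of "\<lambda>k. {Inl k}" UNIV "\<lambda>k z. z (Inl k)" "\<lambda>_. borel"]
  by (simp add: disjoint_family_on_def)

lemma indep_Y: "indep_vars (\<lambda>_. borel) (\<lambda>k. Y (k + m)) UNIV"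
  using indep_vars_functions_of_blocks[OF indep, of "\<lambda>k. {Inr (Inl (k + m))}" UNIV
      "\<lambda>k z. z (Inr (Inl (k + m)))" "\<lambda>_. borel"]
  by (simp add: disjoint_family_on_def)

text \<open>Distinct \<open>k\<close> use disjoint pairs of inputs. The shift by \<open>m\<close>
  serves to let the departures overtake the arrivals by \<open>m\<close> jumps.\<close>

lemma indep_difference: "indep_vars (\<lambda>_. borel) (\<lambda>k \<omega>. X k \<omega> - Y (k + m) \<omega>) UNIV"
  using indep_vars_functions_of_blocks[OF indep, of "\<lambda>k. {Inl k, Inr (Inl (k + m))}" UNIV
      "\<lambda>k z. z (Inl k) - z (Inr (Inl (k + m)))" "\<lambda>_. borel"]
  by (simp add: disjoint_family_on_def)

lemma indep_sums: "indep_var borel (\<lambda>\<omega>. \<Sum>k<n. X k \<omega>) borel (\<lambda>\<omega>. \<Sum>k<n. Y (k + m) \<omega>)"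
proof -
  have "indep_var borel (\<lambda>\<omega>. \<Sum>i\<in>Inl ` {..<n}. Z i \<omega>)
      borel (\<lambda>\<omega>. \<Sum>i\<in>(\<lambda>k. Inr (Inl (k + m))) ` {..<n}. Z i \<omega>)"
    by (intro indep_var_sums_disjoint[OF indep]) auto
  then show ?thesis
    by (simp add: sum.reindex inj_on_def)
qed

lemma indep_pair: "indep_var borel (X k) borel (Y l)"
proof -
  have "indep_var borel (\<lambda>\<omega>. \<Sum>i\<in>{Inl k}. Z i \<omega>) borel (\<lambda>\<omega>. \<Sum>i\<in>{Inr (Inl l)}. Z i \<omega>)"
    by (intro indep_var_sums_disjoint[OF indep]) auto
  then show ?thesis by simp
qed

lemma X_laplace: "0 < s \<Longrightarrow> expectation (\<lambda>\<omega>. exp (- s * X n \<omega>)) = 1 / (1 + (s / lam) powr \<alpha>)"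
  by (intro laplace_mittag_leffler X_nonneg X_cdf \<alpha> lam) auto

lemma Y_laplace: "0 < s \<Longrightarrow> expectation (\<lambda>\<omega>. exp (- s * Y n \<omega>)) = 1 / (1 + (s / \<mu>) powr \<alpha>)"
  using Y_cdf unfolding \<alpha>_eq by (intro laplace_mittag_leffler Y_nonneg \<alpha> \<mu>) auto

lemma AE_epoch_X_unbounded: "AE \<omega> in M. \<forall>L::nat. \<exists>n. real L < epoch (\<lambda>k. X k \<omega>) n"
  by (rule AE_epochs_unbounded[OF indep_X X_nonneg lam X_laplace[OF lam]]) (use lam in auto)

lemma AE_epoch_Y_unbounded: "AE \<omega> in M. \<forall>L::nat. \<exists>n. real L < epoch (\<lambda>k. Y k \<omega>) n"
proof -
  have "indep_vars (\<lambda>_. borel) Y UNIV"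
    using indep_Y[of 0] by simp
  then show ?thesis
    by (rule AE_epochs_unbounded[OF _ Y_nonneg \<mu> Y_laplace[OF \<mu>]]) (use \<mu> in auto)
qed

lemma AE_queue_path: "AE \<omega> in M. queue_path (\<lambda>n. X n \<omega>) (\<lambda>n. Y n \<omega>)"
  using AE_epoch_X_unbounded AE_epoch_Y_unbounded AE_space
  by eventually_elim (auto intro!: queue_path.intro X_nonneg Y_nonneg)

section \<open>Unbounded growth of the queues\<close>

lemma AE_X_pos: "AE \<omega> in M. 0 < X n \<omega>"
proof -
  have "prob {\<omega>\<in>space M. X n \<omega> \<le> 0} = cdf (distr M borel (X n)) 0"
    unfolding cdf_def by (subst measure_distr) (auto intro!: arg_cong[where f = prob])
  also have "\<dots> = 0"
    by (simp add: X_cdf mittag_leffler_0)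
  finally have "AE \<omega> in M. \<not> X n \<omega> \<le> 0"
    by (intro AE_iff_measurable[THEN iffD2, of "{\<omega>\<in>space M. X n \<omega> \<le> 0}"])
       (auto simp: emeasure_eq_measure)
  then show ?thesis by (simp add: not_le)
qed

text \<open>As \<open>\<alpha> \<le> 1\<close>, the transform at \<open>s\<close> decays no faster
  than a multiple of \<open>1 / s\<close>, whereas \<open>exp (- s * \<delta>)\<close> decays
  exponentially. So the exponential bound is positive for a suitable \<open>s\<close>, and it is the
  same for all \<open>n\<close>.\<close>

lemma prob_X_small:
  assumes "0 < \<delta>"
  obtains \<eta> where "0 < \<eta>" "\<And>n. \<eta> \<le> \<P>(\<omega> in M. X n \<omega> \<le> \<delta>)"
proof -
  \<comment> \<open>Chosen so that \<open>y\<^sup>2 / 2 = y + y / (\<delta> * lam)\<close>; then the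
    quadratic Taylor polynomial of \<open>exp y\<close> exceeds the linear bound
    \<open>2 + y / (\<delta> * lam)\<close>.\<close>
  define y where "y = 2 + 2 / (\<delta> * lam)"
  define s where "s = y / \<delta>"
  have y: "2 \<le> y" and s: "0 < s" "s * \<delta> = y"
    using assms lam by (auto simp: y_def s_def add_pos_pos)
  have "(s / lam) powr \<alpha> \<le> 1 + s / lam"
  proof (cases "s / lam \<le> 1")
    case True
    then have "(s / lam) powr \<alpha> \<le> 1"
      using s lam \<alpha> by (intro powr_le1) auto
    then show ?thesis
      using s lam by (simp add: add_increasing2)
  next
    case False
    then have "(s / lam) powr \<alpha> \<le> (s / lam) powr 1"
      using \<alpha> by (intro powr_mono) auto
    then show ?thesis
      using s lam by simp
  qed
  then have "1 + (s / lam) powr \<alpha> \<le> 2 + y / (\<delta> * lam)"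
    using assms lam by (simp add: s_def)
  also have "\<dots> < 1 + y + y\<^sup>2 / 2"
  proof -
    have "y\<^sup>2 / 2 = y + y / (\<delta> * lam)"
      by (simp add: y_def power2_eq_square field_simps)
    then show ?thesis using y by linarith
  qed
  also have "\<dots> \<le> exp y"
    using y by (intro exp_lower_Taylor_quadratic) simp
  finally have less: "1 + (s / lam) powr \<alpha> < exp y" .
  show ?thesis
  proof (rule that)
    have "0 < 1 + (s / lam) powr \<alpha>"
      by (intro add_pos_nonneg) auto
    with less have "1 / exp y < 1 / (1 + (s / lam) powr \<alpha>)"
      by (intro divide_strict_left_mono) auto
    then show "0 < 1 / (1 + (s / lam) powr \<alpha>) - exp (- y)"
      by (simp add: exp_minus inverse_eq_divide)
    fix n
    have "1 / (1 + (s / lam) powr \<alpha>) - exp (- y) =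
        expectation (\<lambda>\<omega>. exp (- s * X n \<omega>)) - exp (- s * \<delta>)"
      unfolding X_laplace[OF s(1)] using s by simp
    also have "\<dots> \<le> prob {\<omega>\<in>space M. X n \<omega> < \<delta>}"
      using s X_nonneg by (intro prob_less_ge_laplace) auto
    also have "\<dots> \<le> \<P>(\<omega> in M. X n \<omega> \<le> \<delta>)"
      by (intro finite_measure_mono) auto
    finally show "1 / (1 + (s / lam) powr \<alpha>) - exp (- y) \<le> \<P>(\<omega> in M. X n \<omega> \<le> \<delta>)" .
  qed
qed

text \<open>At \<open>s = \<mu>\<close> the transform is 1 / 2 for every index. With
  \<open>exp (1 / 2) \<le> 7 / 4\<close> the exponential bound leaves
  \<open>1 - 7 / 8\<close>.\<close>

lemma prob_Y_large: "1 / 8 \<le> \<P>(\<omega> in M. 1 / (2 * \<mu>) < Y n \<omega>)"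
proof -
  have "exp (1 / 2) \<le> 1 + 1 / 2 + (1 / 2 :: real)\<^sup>2"
    by (intro exp_bound) auto
  then have "1 / 8 \<le> 1 - exp (1 / 2) * (1 / 2 :: real)"
    by (simp add: power2_eq_square)
  also have "\<dots> = 1 - exp (\<mu> * (1 / (2 * \<mu>))) * expectation (\<lambda>\<omega>. exp (- \<mu> * Y n \<omega>))"
    unfolding Y_laplace[OF \<mu>] using \<mu> by simp
  also have "\<dots> \<le> \<P>(\<omega> in M. 1 / (2 * \<mu>) < Y n \<omega>)"
    using \<mu> Y_nonneg by (intro prob_greater_ge_laplace) auto
  finally show ?thesis .
qed

text \<open>The bound on interarrival times is the threshold \<open>1 / (2 * \<mu>)\<close> for the
  waiting time divided by \<open>r\<close>, so that a whole block fits below the threshold.\<close>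

lemma AE_bursts:
  assumes "1 \<le> r"
  shows "AE \<omega> in M. \<forall>J. \<exists>j\<ge>J. burst r (1 / (2 * \<mu> * r)) (\<lambda>i. Z i \<omega>) j"
proof -
  have "0 < 1 / (2 * \<mu> * r)"
    using assms \<mu> by simp
  then obtain \<eta> where \<eta>: "0 < \<eta>" "\<And>n. \<eta> \<le> \<P>(\<omega> in M. X n \<omega> \<le> 1 / (2 * \<mu> * r))"
    using prob_X_small by blast
  have C1: "\<P>(\<omega> in M. real (C n \<omega>) = 1) = p 1" for n
    using C_prob[of 1 n] K by simp
  show ?thesis
  proof (rule AE_infinitely_many_bursts[OF indep X_nonneg Y_nonneg AE_epoch_Y_unbounded])
    show "0 < min \<eta> (min (1 / 8) (p 1))"
      using \<eta> p1 by simp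
    show "real r * (1 / (2 * \<mu> * r)) \<le> 1 / (2 * \<mu>)"
      using assms \<mu> by simp
    show "min \<eta> (min (1 / 8) (p 1)) \<le> \<P>(\<omega> in M. X n \<omega> \<le> 1 / (2 * \<mu> * r))" for n
      using \<eta>(2)[of n] by linarith
    show "min \<eta> (min (1 / 8) (p 1)) \<le> \<P>(\<omega> in M. 1 / (2 * \<mu>) < Y n \<omega>)" for n
      using prob_Y_large[of n] by linarith
    show "min \<eta> (min (1 / 8) (p 1)) \<le> \<P>(\<omega> in M. real (C n \<omega>) = 1)" for n
      unfolding C1 by linarith
  qed
qed

lemma AE_Limsup_queue_upto:
  assumes "1 \<le> i"
  shows "AE \<omega> in M. Limsup at_top (\<lambda>t. ereal (real
      (queue_upto (\<lambda>n. X n \<omega>) (\<lambda>n. Y n \<omega>) (\<lambda>n. C n \<omega>) i t))) = \<infinity>"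
proof -
  have "AE \<omega> in M. \<forall>r. 1 \<le> r \<longrightarrow> (\<forall>J. \<exists>j\<ge>J. burst r (1 / (2 * \<mu> * r)) (\<lambda>i. Z i \<omega>) j)"
    using AE_bursts by (simp add: AE_all_countable)
  moreover have "AE \<omega> in M. \<forall>n. 0 < X n \<omega>"
    using AE_X_pos by (simp add: AE_all_countable)
  ultimately show ?thesis
    using AE_queue_path
  proof eventually_elim
    case (elim \<omega>)
    interpret queue_path "\<lambda>n. X n \<omega>" "\<lambda>n. Y n \<omega>" "\<lambda>n. C n \<omega>"
      by (rule elim)
    let ?T = "epoch (\<lambda>n. X n \<omega>)"
    show ?case
    proof (rule Limsup_at_top_nat_eq_infinity)
      fix m :: nat and T :: real
      obtain J where J: "real (nat \<lceil>T\<rceil>) < ?T J"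
        using x_unbounded by blast
      \<comment> \<open>Blocks have \<open>m + 1\<close> customers because one of them may leave
        before the block ends.\<close>
      obtain j where j: "J \<le> j" "burst (m + 1) (1 / (2 * \<mu> * (m + 1))) (\<lambda>i. Z i \<omega>) j"
        using elim(1)[rule_format, of "m + 1" J] by auto
      let ?a = "(m + 1) * j" and ?b = "(m + 1) * Suc j"
      obtain k where k: "first_departure (m + 1) (\<lambda>i. Z i \<omega>) j k" "?T ?b < epoch (\<lambda>n. Y n \<omega>) (Suc k)"
        using j(2) by (auto simp: burst_def)
      have "?b - ?a - 1 \<le> queue_upto (\<lambda>n. X n \<omega>) (\<lambda>n. Y n \<omega>) (\<lambda>n. C n \<omega>) i (?T ?b)"
      proof (rule queue_upto_after_burst[OF assms])
        show "0 < X ?a \<omega>" using elim(2) by blast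
        show "C n \<omega> = 1" if "?a \<le> n" "n < ?b" for n
          using j(2) that by (auto simp: burst_def tight_def)
        show "epoch (\<lambda>n. Y n \<omega>) k' \<le> ?T ?a" if "k' < k" for k'
          using k(1) that by (simp add: first_departure_def)
      qed (rule k(2))
      then have "m \<le> queue_upto (\<lambda>n. X n \<omega>) (\<lambda>n. Y n \<omega>) (\<lambda>n. C n \<omega>) i (?T ?b)"
        by simp
      moreover have "?T J \<le> ?T ?b"
        using j(1) x_nonneg by (intro epoch_mono) auto
      then have "T < ?T ?b"
        using J real_nat_ceiling_ge[of T] by linarith
      ultimately show "\<exists>t>T. m \<le> queue_upto (\<lambda>n. X n \<omega>) (\<lambda>n. Y n \<omega>) (\<lambda>n. C n \<omega>) i t"
        by blast
    qed
  qed
qed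

section \<open>Exponential waiting times\<close>

text \<open>
  For index 1 the differences have finite variance and, when the rates are equal, no drift, so
  the Laplace bounds of the heavy-tailed case fail and the central limit theorem takes over.
\<close>

lemma exponential_X: "\<alpha> = 1 \<Longrightarrow> distributed M lborel (X n) (exponential_density lam)"
  and exponential_Y: "\<alpha> = 1 \<Longrightarrow> distributed M lborel (Y n) (exponential_density \<mu>)"
proof -
  have cdf_eq: "\<P>(\<omega> in M. W \<omega> \<le> a) = cdf (distr M borel W) a" if "random_variable borel W" for W a
    using that unfolding cdf_def by (subst measure_distr) (auto intro!: arg_cong[where f = prob])
  assume "\<alpha> = 1"
  then show "distributed M lborel (X n) (exponential_density lam)"
    using lam by (subst exponential_distributed_iff)
      (auto simp: cdf_eq X_cdf mittag_leffler_one mult.commute)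
  show "distributed M lborel (Y n) (exponential_density \<mu>)"
    using \<mu> \<open>\<alpha> = 1\<close> by (subst exponential_distributed_iff)
      (auto simp: cdf_eq Y_cdf \<alpha>_eq mittag_leffler_one mult.commute)
qed

text \<open>The differences are centred at \<open>1 / lam - 1 / \<mu>\<close>, nonnegative by the
  condition on the rates, and have variance \<open>1 / lam\<^sup>2 + 1 / \<mu>\<^sup>2\<close>, so
  the bound from the central limit theorem applies.\<close>

lemma exponential_difference_exceeds:
  assumes "\<alpha> = 1" "lam \<le> \<mu>"
  obtains c where "0 < c" "\<And>L. \<exists>n. c \<le> prob {\<omega>\<in>space M. L < (\<Sum>k<n. X k \<omega> - Y (k + m) \<omega>)}"
proof -
  note DX = exponential_X[OF \<open>\<alpha> = 1\<close>] and DY = exponential_Y[OF \<open>\<alpha> = 1\<close>]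
  have X1: "integrable M (X k)" "expectation (X k) = 1 / lam"
    and X2: "integrable M (\<lambda>\<omega>. (X k \<omega>)\<^sup>2)" "expectation (\<lambda>\<omega>. (X k \<omega>)\<^sup>2) = 2 / lam\<^sup>2" for k
    using erlang_ith_moment_integrable[OF lam DX, of k 1] erlang_ith_moment[OF lam DX, of k 1]
      erlang_ith_moment_integrable[OF lam DX, of k 2] erlang_ith_moment[OF lam DX, of k 2]
    by simp_all
  have Y1: "integrable M (Y k)" "expectation (Y k) = 1 / \<mu>"
    and Y2: "integrable M (\<lambda>\<omega>. (Y k \<omega>)\<^sup>2)" "expectation (\<lambda>\<omega>. (Y k \<omega>)\<^sup>2) = 2 / \<mu>\<^sup>2" for k
    using erlang_ith_moment_integrable[OF \<mu> DY, of k 1] erlang_ith_moment[OF \<mu> DY, of k 1]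
      erlang_ith_moment_integrable[OF \<mu> DY, of k 2] erlang_ith_moment[OF \<mu> DY, of k 2]
    by simp_all
  have XY: "integrable M (\<lambda>\<omega>. X k \<omega> * Y l \<omega>)" "expectation (\<lambda>\<omega>. X k \<omega> * Y l \<omega>) = 1 / lam * (1 / \<mu>)" for k l
    using indep_var_integrable[OF indep_pair X1(1) Y1(1)]
      indep_var_lebesgue_integral[OF indep_pair X1(1) Y1(1)] by (simp_all add: X1 Y1)
  define D where "D k \<omega> = X k \<omega> - Y (k + m) \<omega>" for k \<omega>
  have sq: "(D k \<omega>)\<^sup>2 = (X k \<omega>)\<^sup>2 + (Y (k + m) \<omega>)\<^sup>2 - 2 * (X k \<omega> * Y (k + m) \<omega>)" for k \<omega>
    by (simp add: D_def power2_eq_square algebra_simps)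
  have D2: "integrable M (\<lambda>\<omega>. (D k \<omega>)\<^sup>2)" for k
    unfolding sq using X2 Y2 XY by simp
  have ED: "expectation (D k) = 1 / lam - 1 / \<mu>" for k
    unfolding D_def using X1 Y1 by simp
  have ED2: "expectation (\<lambda>\<omega>. (D k \<omega>)\<^sup>2) = 2 / lam\<^sup>2 + 2 / \<mu>\<^sup>2 - 2 * (1 / lam * (1 / \<mu>))" for k
    unfolding sq using X2 Y2 XY by simp
  have int: "integrable M (D k)" for k
    unfolding D_def using X1 Y1 by simp
  have "variance (D k) = 1 / lam\<^sup>2 + 1 / \<mu>\<^sup>2" for k
  proof -
    have "variance (D k) = 2 / lam\<^sup>2 + 2 / \<mu>\<^sup>2 - 2 * (1 / lam * (1 / \<mu>)) - (1 / lam - 1 / \<mu>)\<^sup>2"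
      using variance_eq[OF int[of k] D2[of k]] unfolding ED ED2 .
    also have "\<dots> = 1 / lam\<^sup>2 + 1 / \<mu>\<^sup>2"
      using lam \<mu> by (simp add: power2_eq_square field_simps)
    finally show ?thesis .
  qed
  then have var: "variance (D k) = (sqrt (1 / lam\<^sup>2 + 1 / \<mu>\<^sup>2))\<^sup>2" for k
    by simp
  \<comment> \<open>The central limit theorem asks for one common law. It is written as the image of
    a product of two exponential laws, an expression free of \<open>k\<close>.\<close>
  have distr: "distr M borel (D k) =
      distr (density lborel (exponential_density lam) \<Otimes>\<^sub>M density lborel (exponential_density \<mu>)) borel
        (\<lambda>(x, y). x - y)" for k
  proof -
    have "density lborel (exponential_density lam) = distr M borel (X k)"
      using distributed_distr_eq_density[OF DX[of k]] by (metis distr_cong sets_lborel)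
    moreover have "density lborel (exponential_density \<mu>) = distr M borel (Y (k + m))"
      using distributed_distr_eq_density[OF DY[of "k + m"]] by (metis distr_cong sets_lborel)
    moreover have "distr M borel (X k) \<Otimes>\<^sub>M distr M borel (Y (k + m)) =
        distr M (borel \<Otimes>\<^sub>M borel) (\<lambda>\<omega>. (X k \<omega>, Y (k + m) \<omega>))"
      using indep_pair by (simp add: indep_var_distribution_eq)
    ultimately show ?thesis
      by (simp add: distr_distr comp_def D_def[abs_def])
  qed
  obtain c where "0 < c" "\<And>L. \<exists>n. c \<le> prob {\<omega>\<in>space M. L < (\<Sum>k<n. D k \<omega>)}"
  proof (rule central_limit_sum_exceeds[OF _ ED _ D2 var _ distr])
    show "indep_vars (\<lambda>_. borel) D UNIV"
      unfolding D_def[abs_def] by (rule indep_difference)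
    show "0 \<le> 1 / lam - 1 / \<mu>"
      using lam \<mu> assms by (simp add: divide_simps)
    show "0 < sqrt (1 / lam\<^sup>2 + 1 / \<mu>\<^sup>2)"
      using lam \<mu> by (simp add: add_pos_pos)
  qed blast
  then show ?thesis
    using that by (simp add: D_def)
qed

section \<open>Emptying of the queue\<close>

lemma AE_departures_overtake:
  assumes "\<alpha> < 1 \<or> lam \<le> \<mu>"
  shows "AE \<omega> in M. \<forall>m. \<exists>n. epoch (\<lambda>k. Y k \<omega>) (n + m) < epoch (\<lambda>k. X k \<omega>) n"
  unfolding AE_all_countable
proof
  fix m
  obtain c where "0 < c" "\<And>L. \<exists>n. c \<le> prob {\<omega>\<in>space M. L < (\<Sum>k<n. X k \<omega> - Y (k + m) \<omega>)}"
  proof (cases "\<alpha> < 1")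
    case True
    show ?thesis
      by (rule heavy_tailed_difference_exceeds[OF indep_X X_nonneg indep_Y[of m] Y_nonneg indep_sums
            X_laplace Y_laplace \<alpha>(1) True lam \<mu>]) (assumption | rule that)+
  next
    case False
    then have "\<alpha> = 1" "lam \<le> \<mu>"
      using assms \<alpha> by auto
    then show ?thesis
      by (rule exponential_difference_exceeds[where m = m]) (assumption | rule that)+
  qed
  then have "AE \<omega> in M. \<forall>L::nat. \<exists>n. real L < (\<Sum>k<n. X k \<omega> - Y (k + m) \<omega>)"
    by (intro AE_unbounded_partial_sums indep_difference)
  then show "AE \<omega> in M. \<exists>n. epoch (\<lambda>k. Y k \<omega>) (n + m) < epoch (\<lambda>k. X k \<omega>) n"
  proof eventually_elim
    case (elim \<omega>)
    \<comment> \<open>The level to exceed is the time of departure jump \<open>m\<close>, the part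
      of the departure epoch that the shifted sum leaves out.\<close>
    obtain n where "real (nat \<lceil>epoch (\<lambda>k. Y k \<omega>) m\<rceil>) < (\<Sum>k<n. X k \<omega> - Y (k + m) \<omega>)"
      using elim by blast
    then have "epoch (\<lambda>k. Y k \<omega>) m < (\<Sum>k<n. X k \<omega>) - (\<Sum>k<n. Y (k + m) \<omega>)"
      using real_nat_ceiling_ge[of "epoch (\<lambda>k. Y k \<omega>) m"] by (simp add: sum_subtractf)
    moreover have "epoch (\<lambda>k. Y k \<omega>) (n + m) = epoch (\<lambda>k. Y k \<omega>) m + (\<Sum>k<n. Y (k + m) \<omega>)"
      by (induction n) (simp_all add: epoch_Suc epoch_0)
    ultimately show ?case
      by (intro exI[of _ n]) (simp add: epoch_def)
  qed
qed

text \<open>The case excluded by the hypothesis, index 1 with \<open>lam > \<mu>\<close>, is the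
  transient M/M/1 queue, which almost surely stays nonempty from some time on.\<close>

lemma AE_queue_empties:
  assumes "\<alpha> < 1 \<or> lam \<le> \<mu>"
  shows "AE \<omega> in M. \<forall>T>0. \<exists>t>T. queue_upto (\<lambda>n. X n \<omega>) (\<lambda>n. Y n \<omega>) (\<lambda>n. C n \<omega>) K t = 0"
  using AE_departures_overtake[OF assms] AE_queue_path
  by eventually_elim (blast intro: queue_path.queue_empties_if_departures_overtake)

end

theorem theorem2p12:
  fixes M :: "'w measure"
    and \<alpha> \<beta> lam \<mu> :: real and K :: nat and p :: "nat \<Rightarrow> real"
    and X Y :: "nat \<Rightarrow> 'w \<Rightarrow> real" and C :: "nat \<Rightarrow> 'w \<Rightarrow> nat"
  assumes "\<alpha> = \<beta>" and "0 < \<alpha>" and "\<alpha> \<le> 1"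
    and "0 < lam" and "0 < \<mu>"
    and "1 \<le> K"
    and "\<forall>i\<in>{1..K}. 0 < p i" and "(\<Sum>i=1..K. p i) = 1"
    and "mittag_leffler_queue M \<alpha> lam \<beta> \<mu> K p X Y C"
  shows "(\<alpha> < 1 \<or> lam \<le> \<mu> \<longrightarrow>
           (AE \<omega> in M. \<forall>T>0. \<exists>t>T.
              queue_upto (\<lambda>n. X n \<omega>) (\<lambda>n. Y n \<omega>) (\<lambda>n. C n \<omega>) K t = 0))
       \<and> (\<forall>i\<in>{1..K}. AE \<omega> in M.
            Limsup at_top (\<lambda>t. ereal (real
              (queue_upto (\<lambda>n. X n \<omega>) (\<lambda>n. Y n \<omega>) (\<lambda>n. C n \<omega>) i t))) = \<infinity>)"
proof -
  interpret mittag_leffler_queue M \<alpha> lam \<beta> \<mu> K p X Y C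
    by fact
  interpret equal_index_queue M \<alpha> lam \<beta> \<mu> K p X Y C
    by unfold_locales (use assms in auto)
  show ?thesis
    using AE_queue_empties AE_Limsup_queue_upto by auto
qed

end
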